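(* Let $n=4k$, let $a_1$ be a nonsquare in $\mathbb{F}_{3^n}$, let $I$ be a primitive $4$th root of unity in $\mathbb{F}_{3^n}$, and let $$a_2=\pm I^k a_1^{(3^k+1)/2}\Big((-1)^k a_1^{(3^k-1)(3^{2k}+1)/4}+a_1^{-(3^k-1)(3^{2k}+1)/4}\Big)$$ (either sign). Then $f:\mathbb{F}_{3^n}\to\mathbb{F}_3$, $f(x)=\operatorname{Tr}_n\big(a_1x^{2(3^k+1)}+a_2x^{(3^k+1)^2}\big)$, is a regular bent function of algebraic degree four belonging to the completed Maiorana–McFarland class.
   Context: $\operatorname{Tr}_n(x)=\sum_{i=0}^{n-1}x^{3^i}$. With $\omega=e^{2\pi i/3}$, $S_f(b)=\sum_{x\in\mathbb{F}_{3^n}}\omega^{f(x)-\operatorname{Tr}_n(bx)}$; $f$ is bent if $|S_f(b)|^2=3^n$ for all $b$, and regular bent if for all $b$, $3^{-n/2}S_f(b)=\omega^{f^*(b)}$ for some $f^*(b)\in\mathbb{F}_3$. Algebraic degree: maximal ternary digit sum of an exponent occurring. EA-equivalence: $g=a\,(f\circ L)+l$ with $L$ affine permutation, $l$ affine, $a\in\mathbb{F}_3^*$; completed class = smallest union of EA-equivalence classes containing the class. Maiorana–McFarland class: functions $f(x,y)=x\cdot\pi(y)+g(y)$ on $\mathbb{F}_3^m\times\mathbb{F}_3^m$ ($n=2m$), $\pi$ a permutation, $g$ arbitrary, with $\mathbb{F}_{3^n}$ identified with $\mathbb{F}_3^m\times\mathbb{F}_3^m$ by an $\mathbb{F}_3$-linear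 isomorphism. *)

theory Defs
  imports
    Complex_Main
    "HOL-Library.Cardinality"
    "HOL-Computational_Algebra.Polynomial"
    "Jordan_Normal_Form.Matrix"
begin

text \<open>
  The field with \<open>3 ^ n\<close> elements is a type \<open>'a :: {field, finite}\<close> with \<open>CARD('a) = 3 ^ n\<close>. The
  field with three elements is its prime subfield, so ternary functions are maps \<open>'a \<Rightarrow> 'a\<close> with
  values in that subfield. The definitions below have their intended meaning only for such types.
\<close>

definition F3 :: "'a::field set" where
  "F3 = {0, 1, 2}"

definition ternary_functions :: "('a::field \<Rightarrow> 'a) set" where
  "ternary_functions = {f. range f \<subseteq> F3}"

definition Tr :: "nat \<Rightarrow> 'a::field \<Rightarrow> 'a" where
  "Tr n x = (\<Sum>i<n. x ^ (3 ^ i))"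

definition \<omega> :: complex where
  "\<omega> = exp (2 * of_real pi * \<i> / 3)"

text \<open>
  \<open>\<omega>\<close> raised to an element of the prime subfield; since \<open>\<omega> ^ 3 = 1\<close>, the choice of the natural
  number representing the element does not matter.
\<close>

definition omega_pow :: "'a::field \<Rightarrow> complex" where
  "omega_pow c = \<omega> ^ (LEAST j. of_nat j = c)"

definition walsh :: "nat \<Rightarrow> ('a::{field,finite} \<Rightarrow> 'a) \<Rightarrow> 'a \<Rightarrow> complex" where
  "walsh n f b = (\<Sum>x\<in>UNIV. omega_pow (f x - Tr n (b * x)))"

definition bent :: "nat \<Rightarrow> ('a::{field,finite} \<Rightarrow> 'a) \<Rightarrow> bool" where
  "bent n f \<longleftrightarrow> f \<in> ternary_functions \<and> (\<forall>b. (cmod (walsh n f b))\<^sup>2 = 3 ^ n)"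

definition regular_bent :: "nat \<Rightarrow> ('a::{field,finite} \<Rightarrow> 'a) \<Rightarrow> bool" where
  "regular_bent n f \<longleftrightarrow> bent n f \<and>
     (\<forall>b. \<exists>c\<in>(F3 :: 'a set). of_real (3 powr (- real n / 2)) * walsh n f b = omega_pow c)"

fun ternary_digit_sum :: "nat \<Rightarrow> nat" where
  "ternary_digit_sum e = (if e = 0 then 0 else e mod 3 + ternary_digit_sum (e div 3))"

declare ternary_digit_sum.simps [simp del]

text \<open>
  The exponents occurring in a function are those of its reduced univariate representation, the
  unique polynomial of degree less than the order of the field that agrees with the function. The
  zero function gets degree 0.
\<close>

definition univariate_rep :: "('a::{field,finite} \<Rightarrow> 'a) \<Rightarrow> 'a poly" where
  "univariate_rep f = (THE p. degree p < CARD('a) \<and> (\<forall>x. poly p x = f x))"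

definition algebraic_degree :: "('a::{field,finite} \<Rightarrow> 'a) \<Rightarrow> nat" where
  "algebraic_degree f =
     Max (insert 0 (ternary_digit_sum ` {e. coeff (univariate_rep f) e \<noteq> 0}))"

definition F3_linear :: "('a::field \<Rightarrow> 'a) \<Rightarrow> bool" where
  "F3_linear A \<longleftrightarrow> (\<forall>x y. A (x + y) = A x + A y) \<and> (\<forall>c\<in>F3. \<forall>x. A (c * x) = c * A x)"

definition F3_affine :: "('a::field \<Rightarrow> 'a) \<Rightarrow> bool" where
  "F3_affine h \<longleftrightarrow> (\<exists>A c. F3_linear A \<and> (\<forall>x. h x = A x + c))"

definition EA_equivalence :: "(('a::field \<Rightarrow> 'a) \<times> ('a \<Rightarrow> 'a)) set" where
  "EA_equivalence = {(f, g). f \<in> ternary_functions \<and> g \<in> ternary_functions \<and>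
     (\<exists>a L l. a \<in> F3 - {0} \<and> F3_affine L \<and> bij L \<and> F3_affine l \<and> l \<in> ternary_functions \<and>
        (\<forall>x. g x = a * f (L x) + l x))}"

text \<open>
  The smallest union of EA-equivalence classes containing \<open>C\<close>, for a set \<open>C\<close> of ternary functions.
\<close>

definition completed_class :: "('a::field \<Rightarrow> 'a) set \<Rightarrow> ('a \<Rightarrow> 'a) set" where
  "completed_class C =
     \<Inter> {U. C \<subseteq> U \<and> (\<exists>K. K \<subseteq> ternary_functions // EA_equivalence \<and> U = \<Union> K)}"

definition F3_vectors :: "nat \<Rightarrow> 'a::field vec set" where
  "F3_vectors m = {v \<in> carrier_vec m. \<forall>i<m. v $ i \<in> F3}"

definition F3_linear_iso :: "nat \<Rightarrow> ('a::field \<Rightarrow> 'a vec \<times> 'a vec) \<Rightarrow> bool" where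
  "F3_linear_iso m \<phi> \<longleftrightarrow> bij_betw \<phi> UNIV (F3_vectors m \<times> F3_vectors m) \<and>
     (\<forall>x y. \<phi> (x + y) = (fst (\<phi> x) + fst (\<phi> y), snd (\<phi> x) + snd (\<phi> y))) \<and>
     (\<forall>c\<in>F3. \<forall>x. \<phi> (c * x) = (c \<cdot>\<^sub>v fst (\<phi> x), c \<cdot>\<^sub>v snd (\<phi> x)))"

text \<open>
  The identification \<open>\<phi>\<close> of the field with pairs of vectors is arbitrary; two choices differ by a
  linear permutation, so the completed class does not depend on it.
\<close>

definition maiorana_mcfarland :: "nat \<Rightarrow> ('a::field \<Rightarrow> 'a) set" where
  "maiorana_mcfarland n = {f. \<exists>m \<phi> \<pi> g.
     n = 2 * m \<and> F3_linear_iso m \<phi> \<and>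
     bij_betw \<pi> (F3_vectors m) (F3_vectors m) \<and> g ` F3_vectors m \<subseteq> F3 \<and>
     (\<forall>z. f z = fst (\<phi> z) \<bullet> \<pi> (snd (\<phi> z)) + g (snd (\<phi> z)))}"

definition primitive_root_of_unity :: "nat \<Rightarrow> 'a::field \<Rightarrow> bool" where
  "primitive_root_of_unity d z \<longleftrightarrow> z ^ d = 1 \<and> (\<forall>j. 0 < j \<and> j < d \<longrightarrow> z ^ j \<noteq> 1)"

end

theory Submission
  imports Defs
begin

text \<open>
  Put \<open>q = 3\<^sup>k\<close>. In characteristic three \<open>x\<^sup>2 - 2 \<alpha> x y + \<alpha>\<^sup>2 y\<^sup>2 = x\<^sup>2 + \<alpha> x y + \<alpha>\<^sup>2 y\<^sup>2\<close>, and the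
  trace allows one to write \<open>a\<^sub>1 x\<^bsup>2(q + 1)\<^esup>\<close> as \<open>u x\<^bsup>2(q + 1)\<^esup> + (a\<^sub>1 - u)\<^bsup>q\<^esup> x\<^bsup>2q(q + 1)\<^esup>\<close>. The formula for
  \<open>a\<^sub>2\<close> is exactly what makes it possible to choose \<open>u\<close> such that \<open>f(x) = Tr(u (x\<^bsup>q\<^esup> (x - \<alpha> x\<^bsup>q^2\<^esup>))\<^sup>2)\<close>
  for some \<open>\<alpha>\<close> with \<open>\<alpha>\<^bsup>q^2 + 1\<^esup> = 1\<close>. The field is the direct sum of the spaces \<open>U\<close> and \<open>V\<close> on which
  \<open>x \<mapsto> \<alpha> x\<^bsup>q^2\<^esup>\<close> acts as \<open>1\<close> and \<open>-1\<close>, respectively, and \<open>f(h + w) = - Tr(u w\<^bsup>q + 2\<^esup> h\<^bsup>q\<^esup>)\<close> for \<open>h\<close> in \<open>U\<close>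
  and \<open>w\<close> in \<open>V\<close>. Since \<open>w \<mapsto> w\<^bsup>q + 2\<^esup>\<close> is injective on \<open>V\<close>, this is a Maiorana-McFarland function
  of the pair \<open>(h, w)\<close>.
\<close>

section \<open>Finite fields of characteristic three\<close>

text \<open>Multiplication by a nonzero \<open>x\<close> permutes the nonzero elements; comparing
  the products over both enumerations gives \<open>x ^ (CARD('a) - 1) = 1\<close>.\<close>

lemma power_CARD_eq_same:
  fixes x :: "'a::{field,finite}"
  shows "x ^ CARD('a) = x"
proof (cases "x = 0")
  case False
  have "bij_betw ((*) x) (UNIV - {0}) (UNIV - {0})"
    by (rule bij_betwI[where g = "\<lambda>y. y / x"]) (use False in auto)
  then have "\<Prod>(UNIV - {0}) = (\<Prod>y\<in>UNIV - {0}. x * y)"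
    using prod.reindex_bij_betw[of "(*) x" _ _ "\<lambda>y. y"] by simp
  then have "x ^ (CARD('a) - 1) = 1"
    by (simp add: prod.distrib card_Diff_singleton)
  then show ?thesis
    by (metis One_nat_def power_minus_mult mult_1 zero_less_card_finite)
qed simp

text \<open>Translation by 1 leaves the sum over the field unchanged, so the number of elements
  vanishes in the field; a power of 3 vanishes only if 3 does.\<close>

lemma three_eq_0:
  assumes "CARD('a::{field,finite}) = 3 ^ n"
  shows "(3::'a) = 0"
proof -
  have "(\<Sum>y\<in>UNIV. y + 1) = (\<Sum>y\<in>UNIV. y :: 'a)"
    by (rule sum.reindex_bij_betw) (rule bij_betwI[where g = "\<lambda>y. y - 1"], auto)
  then have "of_nat (CARD('a)) = (0 :: 'a)"
    by (simp add: sum.distrib)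
  then show ?thesis
    using assms by simp
qed

section \<open>Frobenius powers\<close>

lemma frobenius_add:
  fixes x y :: "'a::field"
  assumes "(3::'a) = 0"
  shows "(x + y) ^ 3 ^ i = x ^ 3 ^ i + y ^ 3 ^ i"
proof (induction i)
  case (Suc i)
  have cube: "(a + b) ^ 3 = a ^ 3 + b ^ 3" for a b :: 'a
  proof -
    have "(a + b) ^ 3 = a ^ 3 + b ^ 3 + 3 * (a\<^sup>2 * b + a * b\<^sup>2)"
      by (simp add: power2_eq_square power3_eq_cube algebra_simps)
    then show ?thesis
      using assms by simp
  qed
  have pow: "z ^ 3 ^ Suc i = (z ^ 3 ^ i) ^ 3" for z :: 'a
    by (simp only: power_Suc2 power_mult)
  show ?case
    by (simp only: pow Suc.IH cube)
qed simp

lemma frobenius_minus: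
  fixes x :: "'a::field"
  shows "(- x) ^ 3 ^ i = - (x ^ 3 ^ i)"
  by (simp add: power_minus_odd)

lemma frobenius_diff:
  fixes x y :: "'a::field"
  assumes "(3::'a) = 0"
  shows "(x - y) ^ 3 ^ i = x ^ 3 ^ i - y ^ 3 ^ i"
  using frobenius_add[OF assms, of x "- y" i] by (simp add: frobenius_minus)

lemma frobenius_sum:
  fixes g :: "'b \<Rightarrow> 'a::field"
  assumes "(3::'a) = 0"
  shows "(\<Sum>j\<in>J. g j) ^ 3 ^ i = (\<Sum>j\<in>J. g j ^ 3 ^ i)"
  by (induction J rule: infinite_finite_induct) (simp_all add: frobenius_add[OF assms])

text \<open>In characteristic three \<open>x ^ 3 - x\<close> factors as
  \<open>x * (x - 1) * (x - 2)\<close>. This criterion turns closure of \<open>F3\<close> under the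
  field operations into Frobenius identities.\<close>

lemma F3_iff_cube:
  fixes x :: "'a::field"
  assumes "(3::'a) = 0"
  shows "x \<in> F3 \<longleftrightarrow> x ^ 3 = x"
proof -
  have "x ^ 3 - x = x * (x - 1) * (x - 2) + 3 * (x\<^sup>2 - x)"
    by (simp add: power2_eq_square power3_eq_cube algebra_simps)
  then have "x ^ 3 - x = x * (x - 1) * (x - 2)"
    using assms by simp
  then have "x ^ 3 = x \<longleftrightarrow> x * (x - 1) * (x - 2) = 0"
    by (metis eq_iff_diff_eq_0)
  then show ?thesis
    by (auto simp: F3_def)
qed

lemma
  fixes x y :: "'a::field"
  assumes "(3::'a) = 0"
  shows F3_add: "x \<in> F3 \<Longrightarrow> y \<in> F3 \<Longrightarrow> x + y \<in> F3"
    and F3_diff: "x \<in> F3 \<Longrightarrow> y \<in> F3 \<Longrightarrow> x - y \<in> F3"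
    and F3_uminus: "x \<in> F3 \<Longrightarrow> - x \<in> F3"
    and F3_mult: "x \<in> F3 \<Longrightarrow> y \<in> F3 \<Longrightarrow> x * y \<in> F3"
  using frobenius_add[OF assms, of x y 1] frobenius_diff[OF assms, of x y 1]
  by (simp_all add: F3_iff_cube[OF assms] power_mult_distrib)

lemma F3_0 [simp]: "0 \<in> F3" and F3_1 [simp]: "1 \<in> F3"
  by (simp_all add: F3_def)

lemma two_eq_minus_1:
  assumes "(3::'a::field) = 0"
  shows "(2::'a) = - 1"
proof -
  have "(2::'a) + 1 = 0"
    using assms by simp
  then show ?thesis
    by (simp add: eq_neg_iff_add_eq_0)
qed

lemma F3_eq:
  assumes "(3::'a::field) = 0"
  shows "(F3::'a set) = {0, 1, - 1}"
  by (simp add: F3_def two_eq_minus_1[OF assms])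

lemma uminus_eq_double:
  fixes x :: "'a::field"
  assumes "(3::'a) = 0"
  shows "- x = x + x"
proof -
  have "x + x + x = 3 * x"
    by simp
  then show ?thesis
    using assms by (simp add: neg_eq_iff_add_eq_0 add.assoc)
qed

lemma one_neq_minus_1:
  assumes "(3::'a::field) = 0"
  shows "(1::'a) \<noteq> - 1"
  using uminus_eq_double[OF assms, of 1] by (metis add_cancel_right_right zero_neq_one)

lemma card_F3:
  assumes "(3::'a::field) = 0"
  shows "card (F3::'a set) = 3"
  using one_neq_minus_1[OF assms] by (simp add: F3_eq[OF assms])

section \<open>The absolute trace\<close>

lemma Tr_add:
  fixes x y :: "'a::field"
  assumes "(3::'a) = 0"
  shows "Tr n (x + y) = Tr n x + Tr n y"
  by (simp add: Tr_def frobenius_add[OF assms] sum.distrib)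

lemma Tr_minus:
  fixes x :: "'a::field"
  shows "Tr n (- x) = - Tr n x"
  by (simp add: Tr_def frobenius_minus sum_negf)

lemma Tr_diff:
  fixes x y :: "'a::field"
  assumes "(3::'a) = 0"
  shows "Tr n (x - y) = Tr n x - Tr n y"
  using Tr_add[OF assms, of n x "- y"] by (simp add: Tr_minus)

lemma Tr_0 [simp]: "Tr n (0::'a::field) = 0"
  by (simp add: Tr_def power_0_left)

text \<open>Cubing shifts the summands by one place, and the new last summand
  \<open>x ^ 3 ^ n\<close> is again \<open>x\<close>.\<close>

lemma Tr_cube:
  fixes x :: "'a::{field,finite}"
  assumes "CARD('a) = 3 ^ n"
  shows "Tr n (x ^ 3) = Tr n x"
proof -
  have "(\<Sum>i<n. x ^ 3 ^ Suc i) + x ^ 3 ^ 0 = (\<Sum>i<Suc n. x ^ 3 ^ i)"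
    by (simp only: sum.lessThan_Suc_shift add.commute)
  also have "\<dots> = (\<Sum>i<n. x ^ 3 ^ i) + x"
    using power_CARD_eq_same[of x] assms by simp
  finally show ?thesis
    by (simp add: Tr_def power_mult)
qed

lemma Tr_frobenius:
  fixes x :: "'a::{field,finite}"
  assumes "CARD('a) = 3 ^ n"
  shows "Tr n (x ^ 3 ^ i) = Tr n x"
proof (induction i)
  case (Suc i)
  have "x ^ 3 ^ Suc i = (x ^ 3 ^ i) ^ 3"
    by (simp only: power_Suc2 power_mult)
  then show ?case
    using Suc Tr_cube[OF assms] by simp
qed simp

lemma Tr_in_F3:
  fixes x :: "'a::{field,finite}"
  assumes "CARD('a) = 3 ^ n"
  shows "Tr n x \<in> F3"
proof -
  note three = three_eq_0[OF assms]
  have "Tr n x ^ 3 = (\<Sum>i<n. (x ^ 3 ^ i) ^ 3)"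
    using frobenius_sum[OF three, of _ "{..<n}" 1] by (simp add: Tr_def)
  also have "\<dots> = Tr n (x ^ 3)"
    by (simp add: Tr_def mult.commute flip: power_mult)
  finally show ?thesis
    using Tr_cube[OF assms] F3_iff_cube[OF three] by simp
qed

lemma univariate_rep_unique:
  fixes f :: "'a::{field,finite} \<Rightarrow> 'a"
  assumes "degree p < CARD('a)" "\<And>x. poly p x = f x"
  shows "univariate_rep f = p"
  unfolding univariate_rep_def
proof (rule the_equality)
  fix r :: "'a poly"
  assume "degree r < CARD('a) \<and> (\<forall>x. poly r x = f x)"
  then show "r = p"
    using assms by (intro poly_eqI_degree[where A = UNIV]) auto
qed (use assms in simp)

text \<open>As a polynomial the trace has degree below the field size and coefficient 1 at exponent
  1, so it cannot vanish at every point.\<close>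

lemma Tr_nonzero:
  assumes "CARD('a) = 3 ^ n" "n \<ge> 1"
  obtains y :: "'a::{field,finite}" where "Tr n y \<noteq> 0"
proof -
  define p :: "'a poly" where "p = (\<Sum>i<n. monom 1 (3 ^ i))"
  have "degree p < 3 ^ n"
    unfolding p_def by (intro degree_sum_less) (auto simp: degree_monom_eq)
  moreover have "coeff p 1 = 1"
    using assms(2) by (simp add: p_def coeff_sum coeff_monom sum.remove[of _ 0])
  then have "p \<noteq> 0"
    by auto
  ultimately have "\<exists>y. poly p y \<noteq> poly 0 y"
    using poly_eqI_degree[of UNIV p 0] assms(1) by auto
  then show ?thesis
    using that by (auto simp: p_def poly_sum poly_monom Tr_def)
qed

lemma Tr_nondegenerate:
  fixes c :: "'a::{field,finite}"
  assumes "CARD('a) = 3 ^ n" "n \<ge> 1" "\<And>x. Tr n (c * x) = 0"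
  shows "c = 0"
proof (rule ccontr)
  assume "c \<noteq> 0"
  obtain y :: 'a where "Tr n y \<noteq> 0"
    using Tr_nonzero assms(1,2) by blast
  then show False
    using assms(3)[of "y / c"] \<open>c \<noteq> 0\<close> by simp
qed

text \<open>One half of Euler's criterion, by counting. Squaring is at most two-to-one, so there are
  at least \<open>M\<close> nonzero squares. They are roots of \<open>X^M - 1\<close>, which has at
  most \<open>M\<close> roots, so a nonsquare is no root; its \<open>M\<close>-th power squares to 1
  and must be -1.\<close>

lemma nonsquare_power:
  fixes a :: "'a::{field,finite}"
  assumes "(3::'a) = 0" "CARD('a) = 2 * M + 1" "\<nexists>y. a = y\<^sup>2"
  shows "a ^ M = - 1"
proof -
  have "a \<noteq> 0"
    using assms(3) by (metis zero_power2)
  have sq1: "x ^ (2 * M) = 1" if "x \<noteq> 0" for x :: 'a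
    using power_CARD_eq_same[of x] assms(2) that by simp
  define S where "S = (\<lambda>y::'a. y\<^sup>2) ` (UNIV - {0})"
  define R where "R = {x::'a. poly (monom 1 M - 1) x = 0}"
  have "card {0, 1 :: 'a} \<le> CARD('a)"
    by (rule card_mono) auto
  then have M: "M > 0"
    using assms(2) by simp
  have "S \<subseteq> R"
    using sq1 by (auto simp: S_def R_def poly_monom power_mult[symmetric])
  have "UNIV - {0::'a} = (\<Union>s\<in>S. {y\<in>UNIV - {0}. y\<^sup>2 = s})"
    by (auto simp: S_def)
  then have "card (UNIV - {0::'a}) = card (\<Union>s\<in>S. {y\<in>UNIV - {0}. y\<^sup>2 = s})"
    by (rule arg_cong)
  also have "\<dots> \<le> (\<Sum>s\<in>S. card {y\<in>UNIV - {0}. y\<^sup>2 = s})"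
    by (rule card_UN_le) simp
  also have "\<dots> \<le> (\<Sum>s\<in>S. 2)"
  proof (rule sum_mono)
    fix s assume "s \<in> S"
    then obtain y where "s = y\<^sup>2"
      by (auto simp: S_def)
    then have "{y\<in>UNIV - {0}. y\<^sup>2 = s} \<subseteq> {y, - y}"
      by (auto simp: power2_eq_iff)
    then have "card {y\<in>UNIV - {0}. y\<^sup>2 = s} \<le> card {y, - y}"
      by (rule card_mono[rotated]) simp
    also have "\<dots> \<le> 2"
      by (simp add: card_insert_if)
    finally show "card {y\<in>UNIV - {0}. y\<^sup>2 = s} \<le> 2" .
  qed
  finally have "M \<le> card S"
    using assms(2) by (simp add: card_Diff_singleton)
  have "coeff (monom 1 M - 1 :: 'a poly) M = 1"
    using M by simp
  then have "monom 1 M - 1 \<noteq> (0 :: 'a poly)"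
    by (metis coeff_0 zero_neq_one)
  then have "card R \<le> degree (monom 1 M - 1 :: 'a poly)"
    unfolding R_def by (rule card_poly_roots_bound)
  also have "\<dots> \<le> M"
    by (intro degree_diff_le) (auto simp: degree_monom_eq)
  finally have "S = R"
    using \<open>S \<subseteq> R\<close> \<open>M \<le> card S\<close> by (intro card_seteq) auto
  have "a \<notin> R"
    using assms(3) \<open>S = R\<close>[symmetric] by (auto simp: S_def)
  then have "a ^ M \<noteq> 1"
    by (simp add: R_def poly_monom)
  moreover have "(a ^ M)\<^sup>2 = 1"
    using sq1[OF \<open>a \<noteq> 0\<close>] by (simp add: mult.commute flip: power_mult)
  ultimately show ?thesis
    by (simp add: power2_eq_1_iff)
qed

section \<open>Characters\<close>

lemma \<omega>_eq: "\<omega> = Complex (- 1 / 2) (sqrt 3 / 2)"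
proof -
  have "\<omega> = cis (2 * pi / 3)"
    by (simp add: \<omega>_def cis_conv_exp mult.commute)
  then show ?thesis
    by (simp add: complex_eq_iff cos_120 sin_120)
qed

lemma \<omega>_cube: "\<omega> ^ 3 = 1"
  by (simp add: \<omega>_eq complex_eq_iff power3_eq_cube)

lemma
  assumes "(3::'a::field) = 0"
  shows omega_pow_0: "omega_pow (0::'a) = 1"
    and omega_pow_1: "omega_pow (1::'a) = \<omega>"
    and omega_pow_minus_1: "omega_pow (- 1 ::'a) = \<omega>\<^sup>2"
proof -
  have "(2::'a) \<noteq> 0" "(2::'a) \<noteq> 1"
    unfolding two_eq_minus_1[OF assms] using one_neq_minus_1[OF assms] by auto
  \<comment> \<open>Since 0, 1, 2 are distinct in the field, the \<open>LEAST\<close> in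
    \<open>omega_pow\<close> picks exactly these representatives.\<close>
  have *: "(LEAST j. of_nat j = (of_nat i :: 'a)) = i" if "i < 3" for i
  proof (rule Least_equality)
    fix j
    assume "of_nat j = (of_nat i :: 'a)"
    then show "i \<le> j"
      using that \<open>(2::'a) \<noteq> 0\<close> \<open>(2::'a) \<noteq> 1\<close>
      by (cases "j = 0 \<or> j = 1"; cases "i = 0 \<or> i = 1 \<or> i = 2") auto
  qed simp
  show "omega_pow (0::'a) = 1" "omega_pow (1::'a) = \<omega>"
    using *[of 0] *[of 1] by (simp_all add: omega_pow_def)
  show "omega_pow (- 1 ::'a) = \<omega>\<^sup>2"
    using *[of 2] two_eq_minus_1[OF assms] by (simp add: omega_pow_def)
qed

lemma omega_pow_add:
  fixes a b :: "'a::field"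
  assumes three: "(3::'a) = 0" and "a \<in> F3" "b \<in> F3"
  shows "omega_pow (a + b) = omega_pow a * omega_pow b"
proof -
  have "\<omega> * (\<omega> * \<omega>) = 1"
    using \<omega>_cube by (simp add: power3_eq_cube mult.assoc)
  moreover have "(1::'a) + 1 = - 1" "(- 1 ::'a) + - 1 = 1"
    using uminus_eq_double[OF three, of 1] uminus_eq_double[OF three, of "- 1"] by simp_all
  ultimately show ?thesis
    using assms(2,3) unfolding F3_eq[OF three] insert_iff empty_iff
    by (elim disjE FalseE; simp only: omega_pow_0[OF three] omega_pow_1[OF three]
        omega_pow_minus_1[OF three] power2_eq_square mult.assoc mult_1 mult_1_right add_0
        add_0_right right_minus left_minus)
qed

lemma cmod_omega_pow: "cmod (omega_pow c) = 1"
proof -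
  have "cmod \<omega> = 1"
    by (simp add: \<omega>_def)
  then show ?thesis
    by (simp add: omega_pow_def norm_power)
qed

text \<open>In characteristic three, closure under addition already gives closure under negation.\<close>

definition F3_subspace :: "'a::field set \<Rightarrow> bool" where
  "F3_subspace U \<longleftrightarrow> 0 \<in> U \<and> (\<forall>x\<in>U. \<forall>y\<in>U. x + y \<in> U)"

lemma F3_subspace_uminus:
  fixes x :: "'a::field"
  assumes "(3::'a) = 0" "F3_subspace U" "x \<in> U"
  shows "- x \<in> U"
  using assms by (metis F3_subspace_def uminus_eq_double)

lemma F3_subspace_scale:
  fixes x :: "'a::field"
  assumes "(3::'a) = 0" "F3_subspace U" "x \<in> U" "c \<in> F3"
  shows "c * x \<in> U"
  using assms F3_subspace_uminus[OF assms(1-3)] by (auto simp: F3_eq F3_subspace_def)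

lemma F3_subspace_sum:
  assumes "F3_subspace U" "\<And>j. j \<in> J \<Longrightarrow> g j \<in> U"
  shows "(\<Sum>j\<in>J. g j) \<in> U"
  using assms(2)
  by (induction J rule: infinite_finite_induct) (use assms(1) in \<open>auto simp: F3_subspace_def\<close>)

text \<open>Translation by \<open>c\<close> permutes \<open>U\<close> and multiplies the sum by
  \<open>omega_pow (\<mu> c)\<close>, which is not 1.\<close>

lemma sum_omega_pow_eq_0:
  fixes \<mu> :: "'a::{field,finite} \<Rightarrow> 'a"
  assumes three: "(3::'a) = 0" and U: "F3_subspace U"
    and F3: "\<And>x. x \<in> U \<Longrightarrow> \<mu> x \<in> F3"
    and add: "\<And>x y. x \<in> U \<Longrightarrow> y \<in> U \<Longrightarrow> \<mu> (x + y) = \<mu> x + \<mu> y"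
    and "c \<in> U" "\<mu> c \<noteq> 0"
  shows "(\<Sum>x\<in>U. omega_pow (\<mu> x)) = 0"
proof -
  define S where "S = (\<Sum>x\<in>U. omega_pow (\<mu> x))"
  have "bij_betw (\<lambda>x. x + c) U U"
    using F3_subspace_uminus[OF three U] U \<open>c \<in> U\<close>
    by (intro bij_betwI[where g = "\<lambda>x. x + - c"]) (auto simp: F3_subspace_def simp del: add_uminus_conv_diff)
  then have "S = (\<Sum>x\<in>U. omega_pow (\<mu> (x + c)))"
    unfolding S_def by (rule sum.reindex_bij_betw[symmetric])
  also have "\<dots> = S * omega_pow (\<mu> c)"
    unfolding S_def sum_distrib_right
    by (intro sum.cong) (simp_all add: add F3 omega_pow_add[OF three] \<open>c \<in> U\<close>)
  finally have "S * (omega_pow (\<mu> c) - 1) = 0"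
    by (simp add: algebra_simps)
  moreover have "\<omega> \<noteq> 1" "\<omega>\<^sup>2 \<noteq> 1"
    by (simp_all add: \<omega>_eq complex_eq_iff power2_eq_square)
  then have "omega_pow (\<mu> c) \<noteq> 1"
    using F3[OF \<open>c \<in> U\<close>] \<open>\<mu> c \<noteq> 0\<close> by (auto simp: F3_eq[OF three] omega_pow_1 omega_pow_minus_1 three)
  ultimately show ?thesis
    by (simp add: S_def)
qed

section \<open>Bases over the prime field\<close>

definition lin_comb :: "'a::field list \<Rightarrow> 'a vec \<Rightarrow> 'a" where
  "lin_comb es v = (\<Sum>i<length es. v $ i * es ! i)"

lemma lin_comb_add:
  assumes "v \<in> carrier_vec (length es)" "w \<in> carrier_vec (length es)"
  shows "lin_comb es (v + w) = lin_comb es v + lin_comb es w"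
  using assms by (simp add: lin_comb_def distrib_right sum.distrib)

lemma lin_comb_smult:
  assumes "v \<in> carrier_vec (length es)"
  shows "lin_comb es (c \<cdot>\<^sub>v v) = c * lin_comb es v"
  using assms by (simp add: lin_comb_def sum_distrib_left mult.assoc)

lemma F3_vectors_add:
  assumes "(3::'a::field) = 0" "v \<in> F3_vectors m" "w \<in> F3_vectors m"
  shows "v + w \<in> (F3_vectors m :: 'a vec set)"
  using assms by (auto simp: F3_vectors_def F3_add)

lemma F3_vectors_smult:
  assumes "(3::'a::field) = 0" "v \<in> F3_vectors m" "c \<in> F3"
  shows "c \<cdot>\<^sub>v v \<in> (F3_vectors m :: 'a vec set)"
  using assms by (auto simp: F3_vectors_def F3_mult)

lemma
  assumes "(3::'a::field) = 0"
  shows card_F3_vectors: "card (F3_vectors m :: 'a vec set) = 3 ^ m"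
    and finite_F3_vectors: "finite (F3_vectors m :: 'a vec set)"
proof -
  let ?X = "{xs. set xs \<subseteq> (F3 :: 'a set) \<and> length xs = m}"
  have "bij_betw vec_of_list ?X (F3_vectors m)"
  proof (rule bij_betwI[where g = list_of_vec])
    show "vec_of_list \<in> ?X \<rightarrow> F3_vectors m"
    proof
      fix xs
      assume "xs \<in> ?X"
      then have "length xs = m" "\<forall>i<m. xs ! i \<in> F3"
        using nth_mem by blast+
      moreover from this have "vec_of_list xs \<in> carrier_vec m"
        by (intro carrier_vecI) simp
      ultimately show "vec_of_list xs \<in> F3_vectors m"
        by (simp only: F3_vectors_def mem_Collect_eq vec_of_list_index simp_thms)
    qed
    show "list_of_vec \<in> F3_vectors m \<rightarrow> ?X"
    proof
      fix v :: "'a vec"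
      assume v: "v \<in> F3_vectors m"
      then have "length (list_of_vec v) = m"
        unfolding F3_vectors_def by simp
      moreover have "set (list_of_vec v) \<subseteq> F3"
      proof
        fix x
        assume "x \<in> set (list_of_vec v)"
        then obtain i where "i < m" "x = v $ i"
          using \<open>length (list_of_vec v) = m\<close> unfolding in_set_conv_nth list_of_vec_index by blast
        then show "x \<in> F3"
          using v unfolding F3_vectors_def by blast
      qed
      ultimately show "list_of_vec v \<in> ?X"
        by blast
    qed
  qed (simp_all only: list_vec vec_list)
  moreover have fin: "finite (F3 :: 'a set)"
    by (simp add: F3_def)
  ultimately show "card (F3_vectors m :: 'a vec set) = 3 ^ m" "finite (F3_vectors m :: 'a vec set)"
    using card_lists_length_eq[OF fin] finite_lists_length_eq[OF fin] card_F3[OF assms]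
    by (auto simp: bij_betw_same_card[symmetric] bij_betw_finite[symmetric])
qed

lemma lin_comb_snoc:
  assumes "v \<in> carrier_vec (Suc (length es))"
  shows "lin_comb (es @ [x]) v = lin_comb es (vec_first v (length es)) + v $ length es * x"
  using assms by (simp add: lin_comb_def nth_append vec_first_def)

text \<open>The basis is a linearly independent list of maximal length.\<close>

lemma F3_subspace_basis:
  fixes U :: "'a::{field,finite} set"
  assumes three: "(3::'a) = 0" and U: "F3_subspace U"
  obtains es where "bij_betw (lin_comb es) (F3_vectors (length es)) U" "set es \<subseteq> U"
proof -
  define P where "P es \<longleftrightarrow> set es \<subseteq> U \<and> inj_on (lin_comb es) (F3_vectors (length es))" for es
  have "P []"
    by (auto simp: P_def F3_vectors_def inj_on_def)
  \<comment> \<open>Injectivity gives \<open>3 ^ length es \<le> CARD('a)\<close>; this bound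
    ensures that a list of maximal length exists.\<close>
  moreover have "length es < CARD('a) + 1" if "P es" for es
  proof -
    have "3 ^ length es \<le> CARD('a)"
      using that card_inj_on_le[of "lin_comb es" "F3_vectors (length es)" UNIV]
      by (simp add: P_def card_F3_vectors[OF three])
    moreover have "length es < 3 ^ length es"
      by (rule power_gt_expt) simp
    ultimately show ?thesis
      by simp
  qed
  ultimately obtain es where es: "P es" and max: "\<And>fs. P fs \<Longrightarrow> length fs \<le> length es"
    using ex_has_greatest_nat[of P "[]" length "CARD('a) + 1"] by blast
  let ?m = "length es"
  have in_U: "lin_comb es v \<in> U" if "v \<in> F3_vectors ?m" for v
    unfolding lin_comb_def
    by (intro F3_subspace_sum[OF U] F3_subspace_scale[OF three U])
      (use that es in \<open>auto simp: F3_vectors_def P_def\<close>)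
  \<comment> \<open>An \<open>x\<close> outside the span could be appended to \<open>es\<close>,
    against maximality.\<close>
  have "x \<in> lin_comb es ` F3_vectors ?m" if "x \<in> U" for x
  proof (rule ccontr)
    assume x: "x \<notin> lin_comb es ` F3_vectors ?m"
    have "inj_on (lin_comb (es @ [x])) (F3_vectors (Suc ?m))"
    proof (rule inj_onI)
      fix v w :: "'a vec"
      assume vw: "v \<in> F3_vectors (Suc ?m)" "w \<in> F3_vectors (Suc ?m)"
        and eq: "lin_comb (es @ [x]) v = lin_comb (es @ [x]) w"
      define v' w' where "v' = vec_first v ?m" and "w' = vec_first w ?m"
      have v'w': "v' \<in> F3_vectors ?m" "w' \<in> F3_vectors ?m"
        using vw by (auto simp: v'_def w'_def F3_vectors_def vec_first_def)
      define d where "d = v $ ?m - w $ ?m"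
      have "d \<in> F3"
        using vw by (auto simp: d_def F3_vectors_def intro: F3_diff[OF three])
      have carr: "v \<in> carrier_vec (Suc ?m)" "w \<in> carrier_vec (Suc ?m)"
        using vw by (auto simp: F3_vectors_def)
      have eq': "lin_comb es w' - lin_comb es v' = d * x"
        using eq carr by (simp add: lin_comb_snoc v'_def w'_def d_def algebra_simps)
      have comb: "c * (lin_comb es w' - lin_comb es v') \<in> lin_comb es ` F3_vectors ?m" if "c \<in> F3" for c
      proof -
        have "c * (lin_comb es w' - lin_comb es v') = lin_comb es (c \<cdot>\<^sub>v (w' + (- 1) \<cdot>\<^sub>v v'))"
          using v'w' by (simp add: F3_vectors_def lin_comb_add lin_comb_smult)
        moreover have "c \<cdot>\<^sub>v (w' + (- 1) \<cdot>\<^sub>v v') \<in> F3_vectors ?m"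
          using v'w' that by (intro F3_vectors_smult[OF three] F3_vectors_add[OF three]) (auto simp: F3_eq[OF three])
        ultimately show ?thesis
          by blast
      qed
      \<comment> \<open>If \<open>d\<close> were 1 or -1, then \<open>d * d = 1\<close>, and
        \<open>comb\<close> with \<open>c = d\<close> would put \<open>x\<close> into the
        span.\<close>
      have "d = 0"
        using comb[OF \<open>d \<in> F3\<close>] x \<open>d \<in> F3\<close> unfolding eq' by (auto simp: F3_eq[OF three])
      then have "v' = w'"
        using eq' es v'w' by (auto simp: P_def inj_on_def)
      show "v = w"
      proof (rule eq_vecI)
        fix i
        assume "i < dim_vec w"
        then have "i < ?m \<or> i = ?m"
          using carr by auto
        moreover have "vec_first v ?m $ i = vec_first w ?m $ i"
          using \<open>v' = w'\<close> by (simp add: v'_def w'_def)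
        ultimately show "v $ i = w $ i"
          using \<open>d = 0\<close> by (auto simp: vec_first_def d_def)
      qed (use carr in auto)
    qed
    then have "P (es @ [x])"
      using es \<open>x \<in> U\<close> by (auto simp: P_def)
    then show False
      using max by fastforce
  qed
  then have "lin_comb es ` F3_vectors ?m = U"
    using in_U by blast
  then show ?thesis
    using es that by (auto simp: P_def bij_betw_def)
qed

section \<open>Functionals on subspaces and coordinates\<close>

definition F3_functional :: "'a::field set \<Rightarrow> ('a \<Rightarrow> 'a) \<Rightarrow> bool" where
  "F3_functional U \<mu> \<longleftrightarrow> (\<forall>x\<in>U. \<mu> x \<in> F3) \<and> (\<forall>x\<in>U. \<forall>y\<in>U. \<mu> (x + y) = \<mu> x + \<mu> y)"

lemma F3_functional_scale:
  fixes x :: "'a::field"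
  assumes three: "(3::'a) = 0" and U: "F3_subspace U"
    and \<mu>: "F3_functional U \<mu>" and "x \<in> U" "c \<in> F3"
  shows "\<mu> (c * x) = c * \<mu> x"
proof -
  have "0 \<in> U"
    using U by (simp add: F3_subspace_def)
  then have "\<mu> (0 + 0) = \<mu> 0 + \<mu> 0"
    using \<mu> unfolding F3_functional_def by blast
  then have "\<mu> 0 = 0"
    by (simp only: add_0_right add_cancel_right_right)
  moreover have "\<mu> (x + x) = \<mu> x + \<mu> x"
    using \<mu> \<open>x \<in> U\<close> unfolding F3_functional_def by blast
  then have "\<mu> (- x) = - \<mu> x"
    by (simp only: uminus_eq_double[OF three])
  ultimately show ?thesis
    using \<open>c \<in> F3\<close> by (auto simp: F3_eq[OF three])
qed

lemma F3_functional_sum: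
  fixes g :: "'b \<Rightarrow> 'a::field"
  assumes three: "(3::'a) = 0" and U: "F3_subspace U"
    and \<mu>: "F3_functional U \<mu>" and "\<And>j. j \<in> J \<Longrightarrow> g j \<in> U"
  shows "\<mu> (\<Sum>j\<in>J. g j) = (\<Sum>j\<in>J. \<mu> (g j))"
proof -
  have "\<mu> 0 = 0"
    using F3_functional_scale[OF three U \<mu>, of 0 0] U by (simp add: F3_subspace_def)
  show ?thesis
    using assms(4)
  proof (induction J rule: infinite_finite_induct)
    case (insert j J)
    have "(\<Sum>j\<in>J. g j) \<in> U"
      using insert.prems by (intro F3_subspace_sum[OF U]) auto
    then have "\<mu> (g j + (\<Sum>j\<in>J. g j)) = \<mu> (g j) + \<mu> (\<Sum>j\<in>J. g j)"
      using \<mu> insert.prems unfolding F3_functional_def by blast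
    then show ?case
      using insert by simp
  qed (simp_all add: \<open>\<mu> 0 = 0\<close>)
qed

text \<open>A functional is the scalar product with its values on the basis; this is the source of
  the scalar product in the Maiorana-McFarland form.\<close>

lemma F3_functional_lin_comb:
  fixes U :: "'a::field set"
  assumes three: "(3::'a) = 0" and U: "F3_subspace U" and \<mu>: "F3_functional U \<mu>"
    and es: "set es \<subseteq> U" and x: "x \<in> F3_vectors (length es)"
  shows "\<mu> (lin_comb es x) = x \<bullet> vec (length es) (\<lambda>i. \<mu> (es ! i))"
proof -
  have *: "x $ i \<in> F3" "es ! i \<in> U" if "i < length es" for i
    using that x es by (auto simp: F3_vectors_def)
  have "\<mu> (lin_comb es x) = (\<Sum>i<length es. \<mu> (x $ i * es ! i))"
    unfolding lin_comb_def
    by (intro F3_functional_sum[OF three U \<mu>] F3_subspace_scale[OF three U]) (use * in auto)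
  also have "\<dots> = (\<Sum>i<length es. x $ i * \<mu> (es ! i))"
    by (intro sum.cong F3_functional_scale[OF three U \<mu>]) (use * in auto)
  finally show ?thesis
    by (simp add: scalar_prod_def atLeast0LessThan)
qed

lemma F3_functional_Tr:
  assumes "CARD('a::{field,finite}) = 3 ^ n"
  shows "F3_functional U (\<lambda>h::'a. Tr n (b * h))"
  using Tr_in_F3[OF assms] Tr_add[OF three_eq_0[OF assms]]
  by (simp add: F3_functional_def distrib_left)

lemma F3_functional_diff:
  fixes U :: "'a::field set"
  assumes three: "(3::'a) = 0" and "F3_functional U \<mu>" "F3_functional U \<nu>"
  shows "F3_functional U (\<lambda>h. \<mu> h - \<nu> h)"
  using assms(2,3) F3_diff[OF three] by (simp add: F3_functional_def)

text \<open>The cardinality fixes the length of a basis; the coordinate map is the inverse of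
  \<open>lin_comb\<close> and inherits its linearity.\<close>

lemma F3_subspace_coordinates:
  fixes U :: "'a::{field,finite} set"
  assumes three: "(3::'a) = 0" and U: "F3_subspace U" and card: "card U = 3 ^ m"
  obtains es c where "length es = m" "set es \<subseteq> U"
    "bij_betw (lin_comb es) (F3_vectors m) U" "bij_betw c U (F3_vectors m)"
    "\<And>x. x \<in> U \<Longrightarrow> lin_comb es (c x) = x"
    "\<And>x y. x \<in> U \<Longrightarrow> y \<in> U \<Longrightarrow> c (x + y) = c x + c y"
    "\<And>a x. a \<in> F3 \<Longrightarrow> x \<in> U \<Longrightarrow> c (a * x) = a \<cdot>\<^sub>v c x"
proof -
  obtain es where es: "bij_betw (lin_comb es) (F3_vectors (length es)) U" "set es \<subseteq> U"
    using F3_subspace_basis[OF three U] .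
  have "(3::nat) ^ length es = 3 ^ m"
    using bij_betw_same_card[OF es(1)] card by (simp add: card_F3_vectors[OF three])
  then have [simp]: "length es = m"
    by simp
  note es = es[unfolded \<open>length es = m\<close>]
  define c where "c = inv_into (F3_vectors m) (lin_comb es)"
  have c: "bij_betw c U (F3_vectors m)"
    unfolding c_def using es(1) by (rule bij_betw_inv_into)
  then have c_in: "c x \<in> F3_vectors m" if "x \<in> U" for x
    using that bij_betwE by blast
  have right: "lin_comb es (c x) = x" if "x \<in> U" for x
    unfolding c_def using es(1) that by (rule bij_betw_inv_into_right)
  have left: "c (lin_comb es v) = v" if "v \<in> F3_vectors m" for v
    unfolding c_def using es(1) that by (rule bij_betw_inv_into_left)
  have carr: "c x \<in> carrier_vec (length es)" if "x \<in> U" for x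
    using c_in[OF that] by (simp add: F3_vectors_def)
  show ?thesis
  proof (rule that[OF _ es(2,1) c right])
    show "c (x + y) = c x + c y" if "x \<in> U" "y \<in> U" for x y
      using left[OF F3_vectors_add[OF three c_in c_in], OF that] that
      by (simp add: lin_comb_add[OF carr carr] right)
    show "c (a * x) = a \<cdot>\<^sub>v c x" if "a \<in> F3" "x \<in> U" for a x
      using left[OF F3_vectors_smult[OF three c_in], OF that(2,1)] that
      by (simp add: lin_comb_smult[OF carr] right)
  qed simp_all
qed

section \<open>Functions that are linear on the cosets of a half-dimensional subspace\<close>

text \<open>An abstract, coordinate-free Maiorana-McFarland situation: \<open>\<Lambda> w\<close>
  stands for the restriction of a function to the coset \<open>w + U\<close>. Equal dimensions of
  \<open>U\<close> and \<open>V\<close> and separation make \<open>w \<mapsto> \<Lambda> w\<close> a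
  bijection from \<open>V\<close> to the dual of \<open>U\<close>.\<close>

locale F3_pairing =
  fixes m n :: nat and U V :: "'a::{field,finite} set" and \<Lambda> :: "'a \<Rightarrow> 'a \<Rightarrow> 'a"
  assumes n: "n = 2 * m" and CARD: "CARD('a) = 3 ^ n"
    and U: "F3_subspace U" "card U = 3 ^ m" and V: "F3_subspace V" "card V = 3 ^ m"
    and decomposition: "bij_betw (\<lambda>(h, w). h + w) (U \<times> V) UNIV"
    and functional: "\<And>w. w \<in> V \<Longrightarrow> F3_functional U (\<Lambda> w)"
    and separating: "\<And>w w'. w \<in> V \<Longrightarrow> w' \<in> V \<Longrightarrow> (\<And>h. h \<in> U \<Longrightarrow> \<Lambda> w h = \<Lambda> w' h) \<Longrightarrow> w = w'"
begin

lemmas three = three_eq_0[OF CARD]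

lemma ex_split:
  obtains h w where "h \<in> U" "w \<in> V" "z = h + w"
proof -
  have "z \<in> (\<lambda>(h, w). h + w) ` (U \<times> V)"
    using decomposition by (simp add: bij_betw_def)
  then show ?thesis
    using that by auto
qed

text \<open>A functional is determined by its values on the basis, so separation gives injectivity,
  and a finite set mapped injectively into itself is permuted. This map serves as the permutation
  \<open>\<pi>\<close> of the Maiorana-McFarland form.\<close>

lemma bij_dual:
  assumes "length es = m" "set es \<subseteq> U" "bij_betw (lin_comb es) (F3_vectors m) U"
    and fs: "bij_betw (lin_comb fs) (F3_vectors m) V"
  shows "bij_betw (\<lambda>y. vec m (\<lambda>i. \<Lambda> (lin_comb fs y) (es ! i))) (F3_vectors m) (F3_vectors m)"
    (is "bij_betw ?\<pi> _ _")
proof -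
  have fs_V: "lin_comb fs y \<in> V" if "y \<in> F3_vectors m" for y
    using that fs bij_betwE by blast
  have "?\<pi> ` F3_vectors m \<subseteq> F3_vectors m"
  proof (rule image_subsetI)
    fix y :: "'a vec"
    assume "y \<in> F3_vectors m"
    moreover have "es ! i \<in> U" if "i < m" for i
      using assms(1,2) that by auto
    ultimately show "?\<pi> y \<in> F3_vectors m"
      using functional[OF fs_V] unfolding F3_vectors_def F3_functional_def by auto
  qed
  moreover have "inj_on ?\<pi> (F3_vectors m)"
  proof (rule inj_onI)
    fix y y' :: "'a vec"
    assume y: "y \<in> F3_vectors m" "y' \<in> F3_vectors m" and eq: "?\<pi> y = ?\<pi> y'"
    have "\<Lambda> (lin_comb fs y) h = \<Lambda> (lin_comb fs y') h" if "h \<in> U" for h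
    proof -
      obtain x where "x \<in> F3_vectors (length es)" "h = lin_comb es x"
        using assms(1,3) \<open>h \<in> U\<close> unfolding bij_betw_def by auto
      then show ?thesis
        using F3_functional_lin_comb[OF three U(1) functional assms(2)] fs_V y assms(1) eq by simp
    qed
    then have "lin_comb fs y = lin_comb fs y'"
      using fs_V y separating by blast
    then show "y = y'"
      using fs y unfolding bij_betw_def inj_on_def by blast
  qed
  ultimately show ?thesis
    using endo_inj_surj[OF finite_F3_vectors[OF three]] by (simp add: bij_betw_def)
qed

text \<open>This is surjectivity in \<open>bij_dual\<close>, freed from coordinates.\<close>

lemma ex_dual:
  assumes \<mu>: "F3_functional U \<mu>"
  obtains w where "w \<in> V" "\<And>h. h \<in> U \<Longrightarrow> \<Lambda> w h = \<mu> h"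
proof -
  obtain es where es: "length es = m" "set es \<subseteq> U" "bij_betw (lin_comb es) (F3_vectors m) U"
    using F3_subspace_coordinates[OF three U] by metis
  obtain fs where fs: "bij_betw (lin_comb fs) (F3_vectors m) V"
    using F3_subspace_coordinates[OF three V] by metis
  have "vec m (\<lambda>i. \<mu> (es ! i)) \<in> F3_vectors m"
    using \<mu> es(1) subsetD[OF es(2) nth_mem] by (auto simp: F3_vectors_def F3_functional_def)
  then obtain y where y: "y \<in> F3_vectors m"
    "vec m (\<lambda>i. \<mu> (es ! i)) = vec m (\<lambda>i. \<Lambda> (lin_comb fs y) (es ! i))"
    using bij_dual[OF es fs] unfolding bij_betw_def by (metis (no_types, lifting) imageE)
  have w: "lin_comb fs y \<in> V"
    using fs y(1) bij_betwE by blast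
  have "\<Lambda> (lin_comb fs y) h = \<mu> h" if "h \<in> U" for h
  proof -
    obtain x where "x \<in> F3_vectors (length es)" "h = lin_comb es x"
      using es \<open>h \<in> U\<close> unfolding bij_betw_def by auto
    then show ?thesis
      using F3_functional_lin_comb[OF three U(1) functional[OF w] es(2)]
        F3_functional_lin_comb[OF three U(1) \<mu> es(2)] es(1) y(2) by simp
  qed
  then show ?thesis
    using that w by blast
qed

text \<open>Summing over \<open>U\<close> first, the inner character sum vanishes unless
  \<open>\<Lambda> w\<close> agrees on \<open>U\<close> with
  \<open>h \<mapsto> Tr n (b * h)\<close>. This happens for exactly one \<open>w0\<close>, which
  leaves \<open>3 ^ m * omega_pow (- Tr n (b * w0))\<close>.\<close>

lemma regular_bent:
  assumes f: "\<And>h w. h \<in> U \<Longrightarrow> w \<in> V \<Longrightarrow> f (h + w) = \<Lambda> w h"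
  shows "regular_bent n f"
proof -
  have f_F3: "f z \<in> F3" for z
  proof -
    obtain h w where "h \<in> U" "w \<in> V" "z = h + w"
      using ex_split .
    then show ?thesis
      using f functional by (simp add: F3_functional_def)
  qed
  have walsh: "\<exists>c\<in>(F3 :: 'a set). walsh n f b = 3 ^ m * omega_pow c" for b
  proof -
    obtain w0 where w0: "w0 \<in> V" "\<And>h. h \<in> U \<Longrightarrow> \<Lambda> w0 h = Tr n (b * h)"
      using ex_dual[OF F3_functional_Tr[OF CARD]] by blast
    have inner: "(\<Sum>h\<in>U. omega_pow (\<Lambda> w h - Tr n (b * h))) = (if w = w0 then 3 ^ m else 0)"
      if "w \<in> V" for w
    proof (cases "w = w0")
      case True
      then show ?thesis
        using w0 U(2) by (simp add: omega_pow_0[OF three])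
    next
      case False
      then obtain c where "c \<in> U" "\<Lambda> w c \<noteq> Tr n (b * c)"
        using separating[OF \<open>w \<in> V\<close> w0(1)] w0(2) by auto
      moreover have "F3_functional U (\<lambda>h. \<Lambda> w h - Tr n (b * h))"
        by (intro F3_functional_diff[OF three] functional F3_functional_Tr[OF CARD] that)
      ultimately show ?thesis
        using False sum_omega_pow_eq_0[OF three U(1), of "\<lambda>h. \<Lambda> w h - Tr n (b * h)" c]
        by (simp add: F3_functional_def)
    qed
    have "walsh n f b = (\<Sum>(h, w)\<in>U \<times> V. omega_pow (f (h + w) - Tr n (b * (h + w))))"
      unfolding walsh_def
      using sum.reindex_bij_betw[OF decomposition, of "\<lambda>x. omega_pow (f x - Tr n (b * x))"]
      by (simp add: case_prod_beta)
    also have "\<dots> = (\<Sum>(h, w)\<in>U \<times> V. omega_pow (\<Lambda> w h - Tr n (b * h)) * omega_pow (- Tr n (b * w)))"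
    proof (intro sum.cong refl, clarify)
      fix h w
      assume hw: "h \<in> U" "w \<in> V"
      have "f (h + w) - Tr n (b * (h + w)) = (\<Lambda> w h - Tr n (b * h)) + - Tr n (b * w)"
        using f hw by (simp add: distrib_left Tr_add[OF three])
      moreover have "\<Lambda> w h - Tr n (b * h) \<in> F3" "- Tr n (b * w) \<in> F3"
        using functional hw Tr_in_F3[OF CARD]
        by (auto simp: F3_functional_def intro: F3_diff[OF three] F3_uminus[OF three])
      ultimately show "omega_pow (f (h + w) - Tr n (b * (h + w))) =
          omega_pow (\<Lambda> w h - Tr n (b * h)) * omega_pow (- Tr n (b * w))"
        by (simp only: omega_pow_add[OF three])
    qed
    also have "\<dots> = (\<Sum>w\<in>V. \<Sum>h\<in>U. omega_pow (\<Lambda> w h - Tr n (b * h)) * omega_pow (- Tr n (b * w)))"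
      by (subst sum.swap) (simp add: sum.cartesian_product)
    also have "\<dots> = (\<Sum>w\<in>V. if w = w0 then 3 ^ m * omega_pow (- Tr n (b * w)) else 0)"
      by (intro sum.cong) (simp_all add: inner flip: sum_distrib_right)
    also have "\<dots> = 3 ^ m * omega_pow (- Tr n (b * w0))"
      using w0(1) by (simp add: sum.delta)
    finally show ?thesis
      using Tr_in_F3[OF CARD] F3_uminus[OF three] by blast
  qed
  have "(cmod (walsh n f b))\<^sup>2 = 3 ^ n" for b
    using walsh[of b] by (auto simp: norm_mult norm_power cmod_omega_pow n mult.commute simp flip: power_mult)
  moreover have "3 powr (- real n / 2) * 3 ^ m = (1::real)"
    by (simp add: n powr_minus powr_realpow)
  then have "of_real (3 powr (- real n / 2)) * (3 ^ m * z) = z" for z :: complex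
    by (metis (no_types, lifting) mult.assoc mult_1 of_real_1 of_real_mult of_real_numeral of_real_power)
  then have "\<exists>c\<in>(F3 :: 'a set). of_real (3 powr (- real n / 2)) * walsh n f b = omega_pow c" for b
  proof -
    obtain c where "c \<in> (F3 :: 'a set)" "walsh n f b = 3 ^ m * omega_pow c"
      using walsh[of b] by blast
    then show ?thesis
      using \<open>\<And>z. of_real (3 powr (- real n / 2)) * (3 ^ m * z) = z\<close> by (metis (lifting))
  qed
  ultimately show ?thesis
    using f_F3 by (auto simp: regular_bent_def bent_def ternary_functions_def)
qed

text \<open>Coordinates on \<open>U\<close> and \<open>V\<close> together give the isomorphism
  \<open>\<phi>\<close>; since \<open>f\<close> is linear, not merely affine, on each coset,
  \<open>g = 0\<close> works.\<close>

lemma in_maiorana_mcfarland: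
  assumes f: "\<And>h w. h \<in> U \<Longrightarrow> w \<in> V \<Longrightarrow> f (h + w) = \<Lambda> w h"
  shows "f \<in> maiorana_mcfarland n"
proof -
  obtain es c where es: "length es = m" "set es \<subseteq> U" "bij_betw (lin_comb es) (F3_vectors m) U"
    and c: "bij_betw c U (F3_vectors m)" "\<And>x. x \<in> U \<Longrightarrow> lin_comb es (c x) = x"
      "\<And>x y. x \<in> U \<Longrightarrow> y \<in> U \<Longrightarrow> c (x + y) = c x + c y"
      "\<And>a x. a \<in> F3 \<Longrightarrow> x \<in> U \<Longrightarrow> c (a * x) = a \<cdot>\<^sub>v c x"
    using F3_subspace_coordinates[OF three U] by metis
  obtain fs d where fs: "bij_betw (lin_comb fs) (F3_vectors m) V"
    and d: "bij_betw d V (F3_vectors m)" "\<And>x. x \<in> V \<Longrightarrow> lin_comb fs (d x) = x"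
      "\<And>x y. x \<in> V \<Longrightarrow> y \<in> V \<Longrightarrow> d (x + y) = d x + d y"
      "\<And>a x. a \<in> F3 \<Longrightarrow> x \<in> V \<Longrightarrow> d (a * x) = a \<cdot>\<^sub>v d x"
    using F3_subspace_coordinates[OF three V] by metis
  define p where "p = inv_into (U \<times> V) (\<lambda>(h, w). h + w)"
  have p: "bij_betw p UNIV (U \<times> V)"
    unfolding p_def using decomposition by (rule bij_betw_inv_into)
  have p_sum: "p (h + w) = (h, w)" if "h \<in> U" "w \<in> V" for h w
    using bij_betw_inv_into_left[OF decomposition, of "(h, w)"] that by (simp add: p_def)
  define \<phi> where "\<phi> = map_prod c d \<circ> p"
  have \<phi>: "\<phi> (h + w) = (c h, d w)" if "h \<in> U" "w \<in> V" for h w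
    using p_sum that by (simp add: \<phi>_def)
  have iso: "F3_linear_iso m \<phi>"
    unfolding F3_linear_iso_def
  proof (intro conjI allI ballI)
    show "bij_betw \<phi> UNIV (F3_vectors m \<times> F3_vectors m)"
      unfolding \<phi>_def using p bij_betw_map_prod[OF c(1) d(1)] by (rule bij_betw_trans)
    show "\<phi> (x + y) = (fst (\<phi> x) + fst (\<phi> y), snd (\<phi> x) + snd (\<phi> y))" for x y
    proof -
      obtain h w where *: "h \<in> U" "w \<in> V" "x = h + w"
        using ex_split .
      obtain h' w' where **: "h' \<in> U" "w' \<in> V" "y = h' + w'"
        using ex_split .
      have "h + h' \<in> U" "w + w' \<in> V"
        using U(1) V(1) * ** by (auto simp: F3_subspace_def)
      moreover have "x + y = (h + h') + (w + w')"
        using * ** by simp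
      ultimately show ?thesis
        using * ** by (simp only: \<phi> c(3) d(3) fst_conv snd_conv)
    qed
    show "\<phi> (a * x) = (a \<cdot>\<^sub>v fst (\<phi> x), a \<cdot>\<^sub>v snd (\<phi> x))" if "a \<in> F3" for a x
    proof -
      obtain h w where *: "h \<in> U" "w \<in> V" "x = h + w"
        using ex_split .
      then have "a * h \<in> U" "a * w \<in> V"
        using F3_subspace_scale[OF three] U(1) V(1) that by auto
      moreover have "a * x = a * h + a * w"
        using * by (simp add: distrib_left)
      ultimately show ?thesis
        using * that by (simp only: \<phi> c(4) d(4) fst_conv snd_conv)
    qed
  qed
  define \<pi> where "\<pi> = (\<lambda>y. vec m (\<lambda>i. \<Lambda> (lin_comb fs y) (es ! i)))"
  have \<pi>: "bij_betw \<pi> (F3_vectors m) (F3_vectors m)"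
    unfolding \<pi>_def using es fs by (rule bij_dual)
  have f_eq: "f z = fst (\<phi> z) \<bullet> \<pi> (snd (\<phi> z)) + 0" for z
  proof -
    obtain h w where *: "h \<in> U" "w \<in> V" "z = h + w"
      using ex_split .
    have "c h \<in> F3_vectors (length es)"
      using c(1) *(1) es(1) bij_betwE by blast
    then have "\<Lambda> w h = c h \<bullet> vec m (\<lambda>i. \<Lambda> w (es ! i))"
      using F3_functional_lin_comb[OF three U(1) functional[OF *(2)] es(2), of "c h"] c(2)[OF *(1)] es(1)
      by simp
    then show ?thesis
      using * by (simp add: f \<phi> \<pi>_def d(2))
  qed
  show ?thesis
    unfolding maiorana_mcfarland_def mem_Collect_eq
    by (intro exI[of _ m] exI[of _ \<phi>] exI[of _ \<pi>] exI[of _ "\<lambda>_. 0"] conjI allI n iso \<pi> f_eq) auto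
qed

end

section \<open>Algebraic degree\<close>

text \<open>Induction splits off the least significant digit \<open>d 0\<close>, the remaining
  digits being shifted down by one place.\<close>

lemma ternary_digits:
  assumes "\<And>j. d j < 3"
  shows "ternary_digit_sum (\<Sum>j<n. d j * 3 ^ j) = (\<Sum>j<n. d j) \<and> (\<Sum>j<n. d j * 3 ^ j) < 3 ^ n"
  using assms
proof (induction n arbitrary: d)
  case 0
  show ?case
    by (simp add: ternary_digit_sum.simps)
next
  case (Suc n)
  have ds: "ternary_digit_sum (c + 3 * b) = c + ternary_digit_sum b" if "c < 3" for b c
    using that ternary_digit_sum.simps[of 0]
    by (cases "c + 3 * b = 0") (simp_all add: ternary_digit_sum.simps[of "c + 3 * b"])
  have IH: "ternary_digit_sum (\<Sum>j<n. d (Suc j) * 3 ^ j) = (\<Sum>j<n. d (Suc j))"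
    "(\<Sum>j<n. d (Suc j) * 3 ^ j) < 3 ^ n"
    using Suc.IH[of "\<lambda>j. d (Suc j)"] Suc.prems by simp_all
  have "(\<Sum>j<Suc n. d j * 3 ^ j) = d 0 + 3 * (\<Sum>j<n. d (Suc j) * 3 ^ j)"
    by (simp add: sum.lessThan_Suc_shift sum_distrib_left mult_ac del: sum.lessThan_Suc)
  then show ?case
    using ds[OF Suc.prems[of 0]] IH Suc.prems[of 0]
    by (simp add: sum.lessThan_Suc_shift del: sum.lessThan_Suc)
qed

lemma ternary_digits3:
  assumes "i < n" "i' < n" "i'' < n" "i \<noteq> i'" "i \<noteq> i''" "i' \<noteq> i''" "a < 3" "b < 3" "c < 3"
  shows "ternary_digit_sum (a * 3 ^ i + b * 3 ^ i' + c * 3 ^ i'') = a + b + c"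
    and "a * 3 ^ i + b * 3 ^ i' + c * 3 ^ i'' < 3 ^ n"
proof -
  define d where "d j = (if j = i then a else 0) + (if j = i' then b else 0) + (if j = i'' then c else 0)" for j
  have "(\<Sum>j<n. d j * 3 ^ j) = (\<Sum>j<n. (if j = i then a * 3 ^ i else 0) +
      (if j = i' then b * 3 ^ i' else 0) + (if j = i'' then c * 3 ^ i'' else 0))"
    by (rule sum.cong) (auto simp: d_def distrib_right)
  then have "(\<Sum>j<n. d j * 3 ^ j) = a * 3 ^ i + b * 3 ^ i' + c * 3 ^ i''"
    using assms(1-3) by (simp add: sum.distrib)
  moreover have "(\<Sum>j<n. d j) = a + b + c"
    using assms(1-3) by (simp add: d_def sum.distrib)
  moreover have "d j < 3" for j
    using assms by (auto simp: d_def)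
  ultimately show "ternary_digit_sum (a * 3 ^ i + b * 3 ^ i' + c * 3 ^ i'') = a + b + c"
    "a * 3 ^ i + b * 3 ^ i' + c * 3 ^ i'' < 3 ^ n"
    using ternary_digits[of d n] by auto
qed

text \<open>The \<open>n\<close>-th iterate of cubing is the identity, so shifts of ternary digits
  are cyclic of length \<open>n\<close>.\<close>

lemma power_frobenius_mod:
  fixes x :: "'a::{field,finite}"
  assumes "CARD('a) = 3 ^ n"
  shows "x ^ 3 ^ (j mod n) = x ^ 3 ^ j"
proof -
  have "y ^ 3 ^ (n * t) = y" for y :: 'a and t
    by (induction t) (use power_CARD_eq_same[where 'a = 'a] assms in \<open>simp_all add: power_add power_mult\<close>)
  from this[of "x ^ 3 ^ (j mod n)" "j div n"] show ?thesis
    by (simp flip: power_mult power_add)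
qed

text \<open>When all occurring exponents share one digit sum, it is enough that some coefficient
  survives; cancellations need no tracking.\<close>

lemma algebraic_degree_eqI:
  fixes f :: "'a::{field,finite} \<Rightarrow> 'a"
  assumes "degree p < CARD('a)" "\<And>x. poly p x = f x" "p \<noteq> 0"
    and "\<And>e. coeff p e \<noteq> 0 \<Longrightarrow> ternary_digit_sum e = D"
  shows "algebraic_degree f = D"
proof -
  have "\<exists>e. coeff p e \<noteq> 0"
    using \<open>p \<noteq> 0\<close> by (auto simp: poly_eq_iff)
  then have "ternary_digit_sum ` {e. coeff p e \<noteq> 0} = {D}"
    using assms(4) by blast
  then show ?thesis
    by (simp add: algebraic_degree_def univariate_rep_unique[OF assms(1,2)])
qed

text \<open>Every conjugate of either monomial reduces to an exponent of digit sum 4, and a nonzero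
  value ensures that not all coefficients cancel.\<close>

lemma algebraic_degree_quartic:
  fixes f :: "'a::{field,finite} \<Rightarrow> 'a"
  assumes CARD: "CARD('a) = 3 ^ n" and n: "n = 4 * k" "k \<ge> 1"
    and f: "\<And>x. f x = Tr n (a1 * x ^ (2 * (3 ^ k + 1)) + a2 * x ^ ((3 ^ k + 1)\<^sup>2))"
    and nonzero: "f x0 \<noteq> 0"
  shows "algebraic_degree f = 4"
proof -
  \<comment> \<open>\<open>E i\<close> and \<open>G i\<close> come from the ternary expansions of
    \<open>2 * (3 ^ k + 1) * 3 ^ i\<close> and \<open>(3 ^ k + 1)\<^sup>2 * 3 ^ i\<close> with
    positions reduced modulo \<open>n\<close>. The zero summand fits \<open>E\<close> to
    \<open>ternary_digits3\<close>.\<close>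
  define E where "E i = 2 * 3 ^ i + 2 * 3 ^ ((i + k) mod n) + (0::nat) * 3 ^ ((i + 2 * k) mod n)" for i
  define G where "G i = 1 * 3 ^ i + 2 * 3 ^ ((i + k) mod n) + (1::nat) * 3 ^ ((i + 2 * k) mod n)" for i
  \<comment> \<open>The positions differ because neither \<open>k\<close> nor \<open>2 * k\<close>
    is a multiple of \<open>n = 4 * k\<close>.\<close>
  have "i \<noteq> (i + k) mod n" "i \<noteq> (i + 2 * k) mod n" "(i + k) mod n \<noteq> (i + 2 * k) mod n" if "i < n" for i
    using that n by (auto simp: mod_if)
  then have E: "ternary_digit_sum (E i) = 4" "E i < 3 ^ n"
    and G: "ternary_digit_sum (G i) = 4" "G i < 3 ^ n" if "i < n" for i
    using that n ternary_digits3[of i n "(i + k) mod n" "(i + 2 * k) mod n" 2 2 0]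
      ternary_digits3[of i n "(i + k) mod n" "(i + 2 * k) mod n" 1 2 1]
    unfolding E_def G_def by simp_all
  define p where "p = (\<Sum>i<n. monom (a1 ^ 3 ^ i) (E i)) + (\<Sum>i<n. monom (a2 ^ 3 ^ i) (G i))"
  have "n > 0"
    using n by simp
  have "degree p < 3 ^ n"
    unfolding p_def
    by (intro degree_add_less degree_sum_less) (use E(2) G(2) in \<open>auto intro: le_less_trans[OF degree_monom_le]\<close>)
  moreover have "poly p x = f x" for x
  proof -
    have "(x ^ (2 * (3 ^ k + 1))) ^ 3 ^ i = x ^ E i" for i
    proof -
      have "x ^ E i = (x ^ 3 ^ i)\<^sup>2 * (x ^ 3 ^ ((i + k) mod n))\<^sup>2"
        by (simp add: E_def power_add mult.commute flip: power_mult)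
      also have "\<dots> = x ^ (2 * 3 ^ i + 2 * 3 ^ (i + k))"
        unfolding power_frobenius_mod[OF CARD] by (simp add: power_add mult.commute flip: power_mult)
      also have "2 * 3 ^ i + 2 * 3 ^ (i + k) = 2 * (3 ^ k + 1) * (3::nat) ^ i"
        by (simp add: power_add algebra_simps)
      finally show ?thesis
        by (simp only: power_mult)
    qed
    moreover have "(x ^ (3 ^ k + 1)\<^sup>2) ^ 3 ^ i = x ^ G i" for i
    proof -
      have "x ^ G i = x ^ 3 ^ i * (x ^ 3 ^ ((i + k) mod n))\<^sup>2 * x ^ 3 ^ ((i + 2 * k) mod n)"
        by (simp add: G_def power_add mult.commute flip: power_mult)
      also have "\<dots> = x ^ (3 ^ i + 2 * 3 ^ (i + k) + 3 ^ (i + 2 * k))"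
        unfolding power_frobenius_mod[OF CARD] by (simp add: power_add mult.commute flip: power_mult)
      also have "3 ^ i + 2 * 3 ^ (i + k) + 3 ^ (i + 2 * k) = (3 ^ k + 1)\<^sup>2 * (3::nat) ^ i"
      proof -
        have "(3::nat) ^ (2 * k) = 3 ^ k * 3 ^ k"
          by (simp only: mult_2 power_add)
        then show ?thesis
          by (simp add: power_add power2_eq_square distrib_left distrib_right mult.assoc)
      qed
      finally show ?thesis
        by (simp only: power_mult)
    qed
    ultimately show ?thesis
      unfolding p_def f Tr_def
      by (simp add: frobenius_add[OF three_eq_0[OF CARD]] power_mult_distrib poly_sum poly_monom sum.distrib)
  qed
  moreover have "ternary_digit_sum e = 4" if "coeff p e \<noteq> 0" for e
  proof (rule ccontr)
    assume "ternary_digit_sum e \<noteq> 4"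
    then have "\<forall>i<n. E i \<noteq> e \<and> G i \<noteq> e"
      using E(1) G(1) by blast
    then show False
      using that by (simp add: p_def coeff_sum)
  qed
  moreover have "p \<noteq> 0"
    using nonzero calculation(2)[of x0] by auto
  ultimately show ?thesis
    using CARD by (intro algebraic_degree_eqI[of p]) auto
qed

section \<open>The quartic form as a trace of a square\<close>

text \<open>The solutions are roots of a polynomial of degree at most \<open>Q\<close>, which is
  nonzero because its coefficient at exponent 1 is \<open>- s\<close>.\<close>

lemma card_fixed_twist:
  fixes \<alpha> s :: "'a::{field,finite}"
  assumes "s \<noteq> 0" "1 < Q"
  shows "card {x. \<alpha> * x ^ Q = s * x} \<le> Q"
proof -
  define p where "p = monom \<alpha> Q - monom s 1"
  have "coeff p 1 = - s"
    using assms(2) by (simp add: p_def)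
  then have "p \<noteq> 0"
    using assms(1) by auto
  have "{x. \<alpha> * x ^ Q = s * x} = {x. poly p x = 0}"
    by (simp add: p_def poly_monom)
  also have "card \<dots> \<le> degree p"
    using \<open>p \<noteq> 0\<close> by (rule card_poly_roots_bound)
  also have "\<dots> \<le> Q"
    unfolding p_def using assms(2)
    by (intro degree_diff_le) (auto intro: order.trans[OF degree_monom_le])
  finally show ?thesis .
qed

text \<open>The condition on \<open>\<alpha>\<close> makes
  \<open>x \<mapsto> \<alpha> * \<sigma> (\<sigma> x)\<close> an involution, so the field splits
  into its eigenspaces. The condition on \<open>\<sigma> (\<sigma> u)\<close> makes the terms not
  linear in \<open>h\<close> change sign under \<open>\<sigma> \<circ> \<sigma>\<close>, so their
  traces vanish.\<close>

lemma trace_of_square_bent: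
  fixes \<alpha> u :: "'a::{field,finite}"
  assumes n: "n = 4 * k" "k \<ge> 1" and CARD: "CARD('a) = 3 ^ n"
    and \<sigma>: "\<And>x :: 'a. \<sigma> x = x ^ 3 ^ k"
    and \<alpha>: "\<alpha> * \<sigma> (\<sigma> \<alpha>) = 1" and "u \<noteq> 0" and u: "\<sigma> (\<sigma> u) = - ((\<alpha> * \<sigma> \<alpha>)\<^sup>2 * u)"
    and f: "\<And>x. f x = Tr n (u * (\<sigma> x * (x - \<alpha> * \<sigma> (\<sigma> x)))\<^sup>2)"
  shows "regular_bent n f" "f \<in> maiorana_mcfarland n"
proof -
  note three = three_eq_0[OF CARD]
  have \<sigma>_add: "\<sigma> (x + y) = \<sigma> x + \<sigma> y" and \<sigma>_diff: "\<sigma> (x - y) = \<sigma> x - \<sigma> y"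
    and \<sigma>_minus: "\<sigma> (- x) = - \<sigma> x" and \<sigma>_mult: "\<sigma> (x * y) = \<sigma> x * \<sigma> y"
    and \<sigma>_divide: "\<sigma> (x / y) = \<sigma> x / \<sigma> y"
    and \<sigma>_power: "\<sigma> (x ^ e) = \<sigma> x ^ e" and \<sigma>_1: "\<sigma> 1 = 1"
    and \<sigma>_eq_0: "\<sigma> x = 0 \<longleftrightarrow> x = 0" for x y e
    by (simp_all add: \<sigma> frobenius_add[OF three] frobenius_diff[OF three] frobenius_minus
        power_mult_distrib power_divide mult.commute flip: power_mult)
  have \<sigma>\<sigma>: "\<sigma> (\<sigma> x) = x ^ 3 ^ (2 * k)" for x
    by (simp add: \<sigma> mult_2 power_add power_mult)
  have "3 ^ n = (3::nat) ^ (2 * k) * 3 ^ (2 * k)"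
    using n by (simp flip: power_add)
  then have \<sigma>4: "\<sigma> (\<sigma> (\<sigma> (\<sigma> x))) = x" for x
    using power_CARD_eq_same[of x] CARD unfolding \<sigma>\<sigma> by (simp add: power_mult)
  have Tr_\<sigma>: "Tr n (\<sigma> x) = Tr n x" for x
    unfolding \<sigma> using Tr_frobenius[OF CARD] .
  have two: "2 * x = - x" for x :: 'a
    by (simp add: two_eq_minus_1[OF three])
  have self_minus: "x = 0" if "x = - x" for x :: 'a
    using trans[OF that uminus_eq_double[OF three]] by (simp only: add_cancel_right_right)
  have Tr_anti: "Tr n y = 0" if "\<sigma> (\<sigma> y) = - y" for y
    using Tr_\<sigma>[of "\<sigma> y"] Tr_\<sigma>[of y] that by (intro self_minus) (simp add: Tr_minus)
  have "\<alpha> \<noteq> 0"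
    using \<alpha> by auto

  define U where "U = {h. \<alpha> * \<sigma> (\<sigma> h) = h}"
  define V where "V = {w. \<alpha> * \<sigma> (\<sigma> w) = - w}"
  \<comment> \<open>This is the trace of the cross term
    \<open>2 * (u * (\<sigma> w * w\<^sup>2) * \<sigma> h)\<close> of the expanded square, with
    \<open>2 = - 1\<close>.\<close>
  define \<Lambda> where "\<Lambda> w h = - Tr n (u * (\<sigma> w * w\<^sup>2) * \<sigma> h)" for w h
  have U: "\<alpha> * \<sigma> (\<sigma> h) = h" "\<sigma> \<alpha> * \<sigma> (\<sigma> (\<sigma> h)) = \<sigma> h" if "h \<in> U" for h
    using that by (auto simp: U_def simp flip: \<sigma>_mult)
  have V: "\<alpha> * \<sigma> (\<sigma> w) = - w" "\<sigma> \<alpha> * \<sigma> (\<sigma> (\<sigma> w)) = - \<sigma> w" if "w \<in> V" for w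
    using that by (auto simp: V_def simp flip: \<sigma>_mult \<sigma>_minus)
  have subspaces: "F3_subspace U" "F3_subspace V"
    by (simp_all add: F3_subspace_def U_def V_def \<sigma>_add distrib_left \<sigma>_eq_0)
  have "1 < (3::nat) ^ (2 * k)"
    using n by (intro one_less_power) auto
  then have "card {x. \<alpha> * x ^ 3 ^ (2 * k) = 1 * x} \<le> 3 ^ (2 * k)"
    "card {x. \<alpha> * x ^ 3 ^ (2 * k) = - 1 * x} \<le> 3 ^ (2 * k)"
    by (intro card_fixed_twist; simp)+
  then have card_le: "card U \<le> 3 ^ (2 * k)" "card V \<le> 3 ^ (2 * k)"
    by (simp_all add: U_def V_def \<sigma>\<sigma>)

  have decomposition: "bij_betw (\<lambda>(h, w). h + w) (U \<times> V) UNIV"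
    unfolding bij_betw_def
  proof
    show "inj_on (\<lambda>(h, w). h + w) (U \<times> V)"
    proof (rule inj_onI, clarify)
      fix h w h' w'
      assume *: "h \<in> U" "w \<in> V" "h' \<in> U" "w' \<in> V" "h + w = h' + w'"
      then have eq: "h - h' = w' - w"
        by (simp add: algebra_simps)
      have "\<alpha> * \<sigma> (\<sigma> (h - h')) = h - h'"
        using U(1) * by (simp add: \<sigma>_diff right_diff_distrib)
      moreover have "\<alpha> * \<sigma> (\<sigma> (w' - w)) = - (w' - w)"
        using V(1) * by (simp add: \<sigma>_diff right_diff_distrib)
      ultimately have "w' - w = - (w' - w)"
        unfolding eq by (rule trans[OF sym])
      then have "w' - w = 0"
        by (rule self_minus)
      then show "h = h' \<and> w = w'"
        using eq by simp
    qed
    have "z \<in> (\<lambda>(h, w). h + w) ` (U \<times> V)" for z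
    proof
      have PP: "\<alpha> * \<sigma> (\<sigma> (\<alpha> * \<sigma> (\<sigma> z))) = z"
        using \<alpha> by (simp add: \<sigma>_mult \<sigma>4 flip: mult.assoc)
      \<comment> \<open>In characteristic three \<open>1 / 2 = - 1\<close>, so the usual projections
        to the eigenspaces of an involution carry the factor -1.\<close>
      have "- (2 * z) = z"
        by (simp only: two minus_minus)
      then show "z = (\<lambda>(h, w). h + w) (- (z + \<alpha> * \<sigma> (\<sigma> z)), - (z - \<alpha> * \<sigma> (\<sigma> z)))"
        by simp
      show "(- (z + \<alpha> * \<sigma> (\<sigma> z)), - (z - \<alpha> * \<sigma> (\<sigma> z))) \<in> U \<times> V"
        using PP by (simp add: U_def V_def \<sigma>_add \<sigma>_diff \<sigma>_minus right_diff_distrib distrib_left)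
    qed
    then show "(\<lambda>(h, w). h + w) ` (U \<times> V) = UNIV"
      by blast
  qed
  then have "card U * card V = 3 ^ (2 * k) * 3 ^ (2 * k)"
    using bij_betw_same_card CARD n by (fastforce simp: card_cartesian_product simp flip: power_add)
  \<comment> \<open>Both factors are at most \<open>3 ^ (2 * k)\<close> and their product is the
    square of this bound, so both attain it.\<close>
  then have cards: "card U = 3 ^ (2 * k)" "card V = 3 ^ (2 * k)"
  proof -
    assume eq: "card U * card V = 3 ^ (2 * k) * (3::nat) ^ (2 * k)"
    have "card U * card V \<le> card U * 3 ^ (2 * k)" "card U * card V \<le> 3 ^ (2 * k) * card V"
      using card_le by simp_all
    then show "card U = 3 ^ (2 * k)" "card V = 3 ^ (2 * k)"
      using card_le unfolding eq by (auto intro: antisym)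
  qed

  \<comment> \<open>With \<open>w\<close> in \<open>V\<close> and \<open>x\<close>, \<open>y\<close> in \<open>U \<union> V\<close> the argument is an eigenvector of \<open>\<sigma> \<circ> \<sigma>\<close>; if the
    eigenvalue is \<open>-1\<close>, its trace vanishes.\<close>
  have anti: "\<sigma> (\<sigma> (u * (w\<^sup>2 * (\<sigma> x * \<sigma> y)))) =
      - (u * ((\<alpha> * \<sigma> (\<sigma> w))\<^sup>2 * ((\<sigma> \<alpha> * \<sigma> (\<sigma> (\<sigma> x))) * (\<sigma> \<alpha> * \<sigma> (\<sigma> (\<sigma> y))))))" for w x y
    by (simp add: \<sigma>_mult \<sigma>_power u power_mult_distrib power2_eq_square mult_ac)
  have f_split: "f (h + w) = \<Lambda> w h" if "h \<in> U" "w \<in> V" for h w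
  proof -
    have "h + w - \<alpha> * \<sigma> (\<sigma> (h + w)) = - w"
      using U(1)[OF that(1)] V(1)[OF that(2)] two[of w] by (simp add: \<sigma>_add distrib_left)
    then have "f (h + w) = Tr n (u * ((\<sigma> h + \<sigma> w) * - w)\<^sup>2)"
      by (simp only: f \<sigma>_add)
    also have "u * ((\<sigma> h + \<sigma> w) * - w)\<^sup>2 =
        u * (w\<^sup>2 * (\<sigma> h * \<sigma> h)) + u * (w\<^sup>2 * (\<sigma> w * \<sigma> w)) + 2 * (u * (\<sigma> w * w\<^sup>2) * \<sigma> h)"
      by (simp add: \<sigma>_add power2_eq_square algebra_simps)
    finally have "f (h + w) = Tr n (u * (w\<^sup>2 * (\<sigma> h * \<sigma> h)) + u * (w\<^sup>2 * (\<sigma> w * \<sigma> w)) +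
        2 * (u * (\<sigma> w * w\<^sup>2) * \<sigma> h))" .
    \<comment> \<open>The eigenvalue is -1 when both \<open>\<sigma>\<close> factors come from the
      same eigenspace; only the mixed term has eigenvalue 1.\<close>
    moreover have "Tr n (u * (w\<^sup>2 * (\<sigma> h * \<sigma> h))) = 0" "Tr n (u * (w\<^sup>2 * (\<sigma> w * \<sigma> w))) = 0"
      by (rule Tr_anti, simp add: anti U[OF that(1)] V[OF that(2)])+
    ultimately show ?thesis
      by (simp add: Tr_add[OF three] Tr_diff[OF three] two \<Lambda>_def)
  qed

  have separating: "w = w'"
    if w: "w \<in> V" "w' \<in> V" and eq: "\<And>h. h \<in> U \<Longrightarrow> \<Lambda> w h = \<Lambda> w' h" for w w'
  proof -
    define e where "e = u * (\<sigma> w * w\<^sup>2 - \<sigma> w' * w'\<^sup>2)"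
    have Tr_e: "Tr n (e * \<sigma> h) = Tr n (u * (\<sigma> w * w\<^sup>2) * \<sigma> h) - Tr n (u * (\<sigma> w' * w'\<^sup>2) * \<sigma> h)" for h
      by (simp add: e_def right_diff_distrib left_diff_distrib Tr_diff[OF three])
    \<comment> \<open>As \<open>\<sigma>\<close> has order dividing 4, splitting its third iterate
      at \<open>x\<close> writes \<open>x\<close> as \<open>\<sigma> h + \<sigma> v\<close>. The
      \<open>h\<close> part vanishes by \<open>eq\<close>, the \<open>v\<close> part because it
      changes sign under \<open>\<sigma> \<circ> \<sigma>\<close>.\<close>
    have "Tr n (e * x) = 0" for x
    proof -
      have "\<sigma> (\<sigma> (\<sigma> x)) \<in> (\<lambda>(h, w). h + w) ` (U \<times> V)"
        using decomposition by (simp add: bij_betw_def)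
      then obtain h v where hv: "h \<in> U" "v \<in> V" "\<sigma> (\<sigma> (\<sigma> x)) = h + v"
        by auto
      have "Tr n (u * (\<sigma> z * z\<^sup>2) * \<sigma> v) = 0" if "z \<in> V" for z
        by (rule Tr_anti)
          (use anti[of z z v] V[OF that] V[OF \<open>v \<in> V\<close>] in \<open>simp add: mult_ac\<close>)
      then have "Tr n (e * \<sigma> v) = 0"
        using w by (simp add: Tr_e)
      moreover have "Tr n (e * \<sigma> h) = 0"
        using eq[OF hv(1)] by (simp add: Tr_e \<Lambda>_def)
      moreover have "x = \<sigma> h + \<sigma> v"
        using \<sigma>4[of x] hv(3) by (simp add: \<sigma>_add)
      ultimately show ?thesis
        by (simp add: distrib_left Tr_add[OF three])
    qed
    then have "e = 0"
      using Tr_nondegenerate[OF CARD] n by simp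
    then have w_eq: "\<sigma> w * w\<^sup>2 = \<sigma> w' * w'\<^sup>2"
      using \<open>u \<noteq> 0\<close> by (simp add: e_def)
    show "w = w'"
    proof (cases "w' = 0")
      case True
      then show ?thesis
        using w_eq \<sigma>_eq_0 by auto
    next
      case False
      \<comment> \<open>The quotient is fixed by \<open>\<sigma> \<circ> \<sigma>\<close>. Comparing
        \<open>\<sigma> r * r\<^sup>2 = 1\<close> with its image under \<open>\<sigma>\<close>
        yields \<open>r ^ 3 = 1\<close>, and cubing is injective.\<close>
      define r where "r = w / w'"
      have r: "\<sigma> r * r\<^sup>2 = 1"
        using w_eq False \<sigma>_eq_0 by (simp add: r_def \<sigma>_divide power_divide)
      then have "r \<noteq> 0"
        by auto
      have "\<sigma> (\<sigma> x) = - x / \<alpha>" if "x \<in> V" for x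
        using V(1)[OF that] \<open>\<alpha> \<noteq> 0\<close> by (simp add: field_simps)
      then have \<sigma>\<sigma>r: "\<sigma> (\<sigma> r) = r"
        using w \<open>\<alpha> \<noteq> 0\<close> by (simp add: r_def \<sigma>_divide)
      have "\<sigma> (\<sigma> r) * (\<sigma> r)\<^sup>2 = 1"
        using arg_cong[OF r, of \<sigma>] by (simp add: \<sigma>_mult \<sigma>_power \<sigma>_1)
      then have "r * (\<sigma> r)\<^sup>2 = (\<sigma> r * r\<^sup>2)\<^sup>2"
        using r \<sigma>\<sigma>r by simp
      then have "(\<sigma> r)\<^sup>2 * r * (r ^ 3 - 1) = 0"
        by (simp add: power2_eq_square power3_eq_cube algebra_simps)
      then have "r ^ 3 = 1"
        using \<open>r \<noteq> 0\<close> \<sigma>_eq_0 by simp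
      then have "(r - 1) ^ 3 = 0"
        using frobenius_diff[OF three, of r 1 1] by simp
      then show ?thesis
        using False by (simp add: r_def)
    qed
  qed

  have "F3_functional U (\<Lambda> w)" for w
    using Tr_in_F3[OF CARD] F3_uminus[OF three]
    by (simp add: F3_functional_def \<Lambda>_def \<sigma>_add distrib_left Tr_add[OF three])
  then interpret F3_pairing "2 * k" n U V \<Lambda>
    using n(1) CARD subspaces cards decomposition separating by unfold_locales auto
  show "regular_bent n f" "f \<in> maiorana_mcfarland n"
    using regular_bent in_maiorana_mcfarland f_split by blast+
qed

section \<open>The coefficients\<close>

text \<open>Passing from \<open>k\<close> to \<open>k + 1\<close> replaces \<open>d\<close> by
  \<open>3 * d + 1\<close>, so both parities flip together. This settles the sign in the norm
  condition on \<open>\<alpha>\<close>.\<close>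

lemma three_power_half_parity: "3 ^ k = 2 * d + 1 \<Longrightarrow> even (k + d)" for d :: nat
proof (induction k arbitrary: d)
  case (Suc k)
  obtain c where c: "3 ^ k = 2 * c + (1::nat)"
    by (metis odd_numeral even_power oddE)
  then have "d = 3 * c + 1"
    using Suc.prems by simp
  then show ?case
    using Suc.IH[OF c] by simp
qed simp

text \<open>The first three conclusions are the hypotheses of \<open>trace_of_square_bent\<close>;
  the last two rewrite the given quartic as the trace of a square.\<close>

lemma quartic_coefficients:
  fixes a1 a2 I \<epsilon> :: "'a::{field,finite}"
  assumes n: "n = 4 * k" and CARD: "CARD('a) = 3 ^ n" and nonsquare: "\<nexists>y. a1 = y\<^sup>2"
    and I: "primitive_root_of_unity 4 I" and \<epsilon>: "\<epsilon> \<in> {1, -1 :: 'a}"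
    and a2: "a2 = \<epsilon> * I ^ k * a1 ^ ((3 ^ k + 1) div 2) *
           ((-1) ^ k * a1 ^ ((3 ^ k - 1) * (3 ^ (2 * k) + 1) div 4) +
            inverse (a1 ^ ((3 ^ k - 1) * (3 ^ (2 * k) + 1) div 4)))"
    and \<sigma>: "\<And>x :: 'a. \<sigma> x = x ^ 3 ^ k"
  obtains \<alpha> u where "\<alpha> * \<sigma> (\<sigma> \<alpha>) = 1" "u \<noteq> 0" "\<sigma> (\<sigma> u) = - ((\<alpha> * \<sigma> \<alpha>)\<^sup>2 * u)"
    "u * \<alpha> = a2" "\<sigma> (a1 - u) = u * \<alpha>\<^sup>2"
proof -
  note three = three_eq_0[OF CARD]
  have \<sigma>_add: "\<sigma> (x + y) = \<sigma> x + \<sigma> y" and \<sigma>_diff: "\<sigma> (x - y) = \<sigma> x - \<sigma> y"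
    and \<sigma>_minus: "\<sigma> (- x) = - \<sigma> x" and \<sigma>_mult: "\<sigma> (x * y) = \<sigma> x * \<sigma> y"
    and \<sigma>_power: "\<sigma> (x ^ e) = \<sigma> x ^ e" and \<sigma>_1: "\<sigma> 1 = 1" for x y e
    by (simp_all add: \<sigma> frobenius_add[OF three] frobenius_diff[OF three] frobenius_minus
        power_mult_distrib mult.commute flip: power_mult)
  \<comment> \<open>With \<open>q = 3 ^ k\<close>, the numbers \<open>d = (q - 1) / 2\<close> and
    \<open>e = (q^2 + 1) / 2\<close> make all divisions in the exponents exact.\<close>
  obtain d :: nat where d: "3 ^ k = 2 * d + (1::nat)"
    by (metis odd_numeral even_power oddE)
  define e where "e = 2 * d\<^sup>2 + 2 * d + 1"
  have e: "3 ^ (2 * k) + 1 = 2 * e"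
  proof -
    have "3 ^ (2 * k) = (2 * d + 1)\<^sup>2"
      by (simp only: mult.commute[of 2] power_mult d)
    then show ?thesis
      by (simp add: e_def power2_eq_square algebra_simps)
  qed
  have exponents: "(3 ^ k + 1) div 2 = d + 1" "(3 ^ k - 1) * (3 ^ (2 * k) + 1) div 4 = d * e"
    unfolding e using d by simp_all
  \<comment> \<open>Half of \<open>3 ^ n - 1 = (q - 1) * (q + 1) * (q^2 + 1)\<close> is
    \<open>d * e * (2 * (2 * d + 2))\<close>, the exponent for Euler's criterion.\<close>
  have "3 ^ n = ((2 * d + 1)\<^sup>2)\<^sup>2"
    unfolding n d[symmetric] by (simp flip: power_mult add: mult.commute)
  also have "\<dots> = 2 * (d * e * (2 * (2 * d + 2))) + 1"
    by (simp add: e_def power2_eq_square algebra_simps)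
  finally have a1_power: "a1 ^ (d * e * (2 * (2 * d + 2))) = - 1"
    using nonsquare_power[OF three _ nonsquare] CARD by simp
  have "a1 \<noteq> 0"
    using nonsquare by (metis zero_power2)

  define A where "A = a1 ^ (d * e)"
  have "A \<noteq> 0"
    using \<open>a1 \<noteq> 0\<close> by (simp add: A_def)
  have A: "(A\<^sup>2) ^ (2 * d + 2) = - 1"
    using a1_power by (simp only: A_def power_mult)
  define B where "B = (- 1) ^ k * A\<^sup>2"
  have sign: "(- 1) ^ j * (- 1) ^ j = (1 :: 'a)" for j :: nat
    by (simp flip: power_mult_distrib)
  have "B \<noteq> 0"
    using \<open>A \<noteq> 0\<close> by (simp add: B_def)
  \<comment> \<open>The signs cancel and the exponents add up to \<open>1 + q = 2 * d + 2\<close>,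
    so this is where \<open>a1\<close> being a nonsquare enters.\<close>
  have B: "B * \<sigma> B = - 1"
  proof -
    have "\<sigma> B = (- 1) ^ k * (A\<^sup>2) ^ (2 * d + 1)"
      by (simp only: B_def \<sigma>_mult \<sigma>_power \<sigma>_minus \<sigma>_1) (simp only: \<sigma> d mult.commute flip: power_mult)
    then have "B * \<sigma> B = ((- 1) ^ k * (- 1) ^ k) * ((A\<^sup>2) * (A\<^sup>2) ^ (2 * d + 1))"
      by (simp only: B_def mult_ac)
    also have "\<dots> = (A\<^sup>2) ^ (2 * d + 2)"
      by (simp only: sign mult_1 flip: power_Suc) simp
    finally show ?thesis
      using A by simp
  qed
  have \<sigma>\<sigma>B: "\<sigma> (\<sigma> B) = B"
  proof -
    have "\<sigma> B * \<sigma> (\<sigma> B) = \<sigma> B * B"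
      using arg_cong[OF B, of \<sigma>] B unfolding \<sigma>_mult \<sigma>_minus \<sigma>_1 by (simp only: mult.commute)
    moreover have "\<sigma> B \<noteq> 0"
      using B by auto
    ultimately show ?thesis
      by simp
  qed
  have "1 + B \<noteq> 0"
  proof
    assume "1 + B = 0"
    then have "B = - 1"
      by (simp add: eq_neg_iff_add_eq_0 add.commute)
    then have "(1::'a) = - 1"
      using B by (simp add: \<sigma>_minus \<sigma>_1)
    then show False
      using one_neq_minus_1[OF three] by simp
  qed

  have "I ^ 4 = 1" "I ^ 2 \<noteq> 1"
    using I by (auto simp: primitive_root_of_unity_def)
  then have I2: "I\<^sup>2 = - 1"
    using power2_eq_1_iff[of "I\<^sup>2"] by (simp flip: power_mult)
  \<comment> \<open>\<open>u\<close> solves \<open>u (a\<^sub>1 - u)\<^bsup>q\<^esup> = a\<^sub>2\<^sup>2 = a\<^sub>1\<^bsup>q + 1\<^esup> (1 + B) (1 + 1/B)\<close>, which says that the quadratic form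
    \<open>u x\<^sup>2 + a\<^sub>2 x y + (a\<^sub>1 - u)\<^bsup>q\<^esup> y\<^sup>2\<close> is a multiple of a square; in characteristic three
    \<open>a\<^sub>1 - u = a\<^sub>1 (B - 1)\<close>.\<close>
  define \<alpha> where "\<alpha> = - (\<epsilon> * I ^ k * a1 ^ d / A)"
  define u where "u = - (a1 * (1 + B))"
  have "\<epsilon>\<^sup>2 = 1"
    using \<epsilon> by auto
  have \<alpha>2: "\<alpha>\<^sup>2 = (- 1) ^ k * a1 ^ (2 * d) / A\<^sup>2"
    by (simp add: \<alpha>_def power_divide power_mult_distrib \<open>\<epsilon>\<^sup>2 = 1\<close> I2 mult.commute flip: power_mult)
      (simp add: power_mult I2 mult.commute[of k])
  \<comment> \<open>The factor \<open>A\<^sup>2\<close> and the sign in \<open>B\<close> cancel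
    those in \<open>\<alpha>\<^sup>2\<close>, leaving \<open>a1 ^ (2 * d + 1)\<close>.\<close>
  have \<sigma>_a1: "\<sigma> a1 = a1 * B * \<alpha>\<^sup>2"
  proof -
    have "a1 * B * \<alpha>\<^sup>2 = ((- 1) ^ k * (- 1) ^ k) * (a1 * a1 ^ (2 * d))"
      using \<open>A \<noteq> 0\<close> by (simp add: B_def \<alpha>2)
    moreover have "\<sigma> a1 = a1 * a1 ^ (2 * d)"
      by (simp add: \<sigma> d)
    ultimately show ?thesis
      by (simp only: sign mult_1)
  qed
  show ?thesis
  proof
    show "u \<noteq> 0"
      using \<open>a1 \<noteq> 0\<close> \<open>1 + B \<noteq> 0\<close> by (simp add: u_def)
    \<comment> \<open>The bracket in the formula for \<open>a2\<close> is
      \<open>(1 + B) / A\<close>; thus \<open>\<alpha>\<close> was chosen as the quotient of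
      \<open>a2\<close> by \<open>u\<close>.\<close>
    have "(1 + B) / A = (- 1) ^ k * A + inverse A"
      using \<open>A \<noteq> 0\<close> by (simp add: B_def field_simps power2_eq_square)
    then have "u * \<alpha> = \<epsilon> * I ^ k * a1 ^ (d + 1) * ((- 1) ^ k * A + inverse A)"
      by (simp add: u_def \<alpha>_def flip: \<open>(1 + B) / A = (- 1) ^ k * A + inverse A\<close>)
    then show "u * \<alpha> = a2"
      unfolding a2 exponents A_def .
    have v: "a1 - u = a1 * (B - 1)"
    proof -
      have "a1 - u = a1 * (B - 1) + 3 * a1"
        by (simp add: u_def algebra_simps)
      then show ?thesis
        using three by simp
    qed
    have "\<sigma> (a1 - u) = a1 * \<alpha>\<^sup>2 * (B * \<sigma> B - B)"
      by (simp add: v \<sigma>_mult \<sigma>_diff \<sigma>_1 \<sigma>_a1 algebra_simps)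
    then show "\<sigma> (a1 - u) = u * \<alpha>\<^sup>2"
      by (simp add: B u_def algebra_simps)
    have "\<sigma> (\<sigma> u) = - (\<sigma> (\<sigma> a1) * (1 + B))"
      by (simp add: u_def \<sigma>_minus \<sigma>_mult \<sigma>_add \<sigma>_1 \<sigma>\<sigma>B)
    also have "\<sigma> (\<sigma> a1) = (B * \<sigma> B) * (a1 * \<alpha>\<^sup>2 * (\<sigma> \<alpha>)\<^sup>2)"
      by (simp add: \<sigma>_a1 \<sigma>_mult \<sigma>_power mult_ac)
    also have "- (B * \<sigma> B * (a1 * \<alpha>\<^sup>2 * (\<sigma> \<alpha>)\<^sup>2) * (1 + B)) = - ((\<alpha> * \<sigma> \<alpha>)\<^sup>2 * u)"
      unfolding B by (simp add: u_def power_mult_distrib)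
    finally show "\<sigma> (\<sigma> u) = - ((\<alpha> * \<sigma> \<alpha>)\<^sup>2 * u)" .
    \<comment> \<open>The norm condition concerns \<open>\<alpha> ^ (2 * e)\<close>, hence
      \<open>(A\<^sup>2) ^ e\<close>. It reduces because \<open>e\<close> is 1 modulo
      \<open>2 * d + 2\<close>, the exponent at which \<open>A\<^sup>2\<close> gives -1.\<close>
    have "(A\<^sup>2) ^ e = ((A\<^sup>2) ^ (2 * d + 2)) ^ d * A\<^sup>2"
    proof -
      have "e = (2 * d + 2) * d + 1"
        by (simp add: e_def power2_eq_square algebra_simps)
      then show ?thesis
        unfolding power_mult[of "A\<^sup>2" "2 * d + 2" d, symmetric] by simp
    qed
    then have A_e: "(A\<^sup>2) ^ e = (- 1) ^ d * A\<^sup>2"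
      by (simp only: A)
    have "odd e"
      by (simp add: e_def)
    moreover have "((- 1) ^ k) ^ e = ((- 1 :: 'a) ^ e) ^ k"
      by (simp only: mult.commute flip: power_mult)
    ultimately have "((- 1) ^ k) ^ e = (- 1 :: 'a) ^ k"
      by simp
    moreover have "(a1 ^ (2 * d)) ^ e = A\<^sup>2"
      by (simp add: A_def mult_ac flip: power_mult)
    ultimately have "(\<alpha>\<^sup>2) ^ e = (- 1) ^ k * A\<^sup>2 / ((- 1) ^ d * A\<^sup>2)"
      by (simp add: \<alpha>2 power_divide power_mult_distrib A_e)
    also have "\<dots> = (- 1) ^ (k + d)"
      using \<open>A \<noteq> 0\<close> sign[of d] by (simp add: power_add divide_eq_eq mult.assoc)
    also have "\<dots> = 1"
      using three_power_half_parity[OF d] by simp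
    finally have "\<alpha> ^ (2 * e) = 1"
      by (simp add: power_mult)
    moreover have "\<alpha> * \<sigma> (\<sigma> \<alpha>) = \<alpha> ^ (3 ^ (2 * k) + 1)"
      by (simp add: \<sigma> mult_2 power_add flip: power_mult)
    ultimately show "\<alpha> * \<sigma> (\<sigma> \<alpha>) = 1"
      by (simp only: e)
  qed
qed

text \<open>\<open>f\<close> is shown to lie in the Maiorana-McFarland class itself; this inclusion
  carries it into the completed class.\<close>

lemma subset_completed_class: "C \<subseteq> completed_class C"
  by (auto simp: completed_class_def)

theorem theorem3:
  fixes a1 a2 I :: "'a::{field,finite}" and f :: "'a \<Rightarrow> 'a" and n k :: nat
  assumes "k \<ge> 1" and "n = 4 * k" and "CARD('a) = 3 ^ n"
    and "\<nexists>y. a1 = y\<^sup>2"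
    and "primitive_root_of_unity 4 I"
    and "\<epsilon> \<in> {1, -1 :: 'a}"
    and "a2 = \<epsilon> * I ^ k * a1 ^ ((3 ^ k + 1) div 2) *
           ((-1) ^ k * a1 ^ ((3 ^ k - 1) * (3 ^ (2 * k) + 1) div 4) +
            inverse (a1 ^ ((3 ^ k - 1) * (3 ^ (2 * k) + 1) div 4)))"
    and "\<And>x. f x = Tr n (a1 * x ^ (2 * (3 ^ k + 1)) + a2 * x ^ ((3 ^ k + 1)\<^sup>2))"
  shows "regular_bent n f \<and> algebraic_degree f = 4 \<and> f \<in> completed_class (maiorana_mcfarland n)"
proof -
  note CARD = assms(3)
  note three = three_eq_0[OF CARD]
  define \<sigma> :: "'a \<Rightarrow> 'a" where "\<sigma> x = x ^ 3 ^ k" for x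
  obtain \<alpha> u where \<alpha>: "\<alpha> * \<sigma> (\<sigma> \<alpha>) = 1" and u: "u \<noteq> 0" "\<sigma> (\<sigma> u) = - ((\<alpha> * \<sigma> \<alpha>)\<^sup>2 * u)"
    and a2: "u * \<alpha> = a2" and v: "\<sigma> (a1 - u) = u * \<alpha>\<^sup>2"
    using quartic_coefficients[OF assms(2-7) \<sigma>_def] .
  have "f x = Tr n (u * (\<sigma> x * (x - \<alpha> * \<sigma> (\<sigma> x)))\<^sup>2)" for x
  proof -
    have "x ^ (2 * (3 ^ k + 1)) = (x * \<sigma> x)\<^sup>2"
      by (simp add: \<sigma>_def mult.commute flip: power_mult power_Suc)
    moreover have "x ^ ((3 ^ k + 1)\<^sup>2) = x * (\<sigma> x)\<^sup>2 * \<sigma> (\<sigma> x)"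
      by (simp add: \<sigma>_def power2_eq_square distrib_left distrib_right power_add mult_ac flip: power_mult)
    ultimately have "f x = Tr n (u * (x * \<sigma> x)\<^sup>2 + (a1 - u) * (x * \<sigma> x)\<^sup>2 + a2 * (x * (\<sigma> x)\<^sup>2 * \<sigma> (\<sigma> x)))"
      by (simp add: assms(8) algebra_simps)
    also have "\<dots> = Tr n (u * (x * \<sigma> x)\<^sup>2) + Tr n ((a1 - u) * (x * \<sigma> x)\<^sup>2) +
        Tr n (a2 * (x * (\<sigma> x)\<^sup>2 * \<sigma> (\<sigma> x)))"
      by (simp only: Tr_add[OF three])
    also have "Tr n ((a1 - u) * (x * \<sigma> x)\<^sup>2) = Tr n (\<sigma> ((a1 - u) * (x * \<sigma> x)\<^sup>2))"
      by (simp only: \<sigma>_def Tr_frobenius[OF CARD])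
    also have "\<sigma> ((a1 - u) * (x * \<sigma> x)\<^sup>2) = \<sigma> (a1 - u) * (\<sigma> x * \<sigma> (\<sigma> x))\<^sup>2"
      by (simp only: \<sigma>_def power_mult_distrib power2_eq_square)
    also have "Tr n (u * (x * \<sigma> x)\<^sup>2) + Tr n (\<sigma> (a1 - u) * (\<sigma> x * \<sigma> (\<sigma> x))\<^sup>2) +
        Tr n (a2 * (x * (\<sigma> x)\<^sup>2 * \<sigma> (\<sigma> x))) =
        Tr n (u * (\<sigma> x)\<^sup>2 * (x\<^sup>2 + \<alpha>\<^sup>2 * (\<sigma> (\<sigma> x))\<^sup>2 + \<alpha> * (x * \<sigma> (\<sigma> x))))"
      unfolding v a2[symmetric] Tr_add[OF three, symmetric]
      by (simp add: power_mult_distrib distrib_left mult_ac)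
    \<comment> \<open>The mixed coefficient 1 equals -2, so adding a multiple of 3 completes the
      square.\<close>
    also have "x\<^sup>2 + \<alpha>\<^sup>2 * (\<sigma> (\<sigma> x))\<^sup>2 + \<alpha> * (x * \<sigma> (\<sigma> x)) = (x - \<alpha> * \<sigma> (\<sigma> x))\<^sup>2 + 3 * (\<alpha> * (x * \<sigma> (\<sigma> x)))"
      by (simp add: power2_eq_square algebra_simps)
    finally show ?thesis
      using three by (simp add: power_mult_distrib mult.assoc)
  qed
  note bent = trace_of_square_bent[OF assms(2,1) CARD \<sigma>_def \<alpha> u this]
  \<comment> \<open>A bent function is not constant, hence the degree does not drop to 0.\<close>
  have "\<exists>x. f x \<noteq> 0"
  proof (rule ccontr)
    assume "\<nexists>x. f x \<noteq> 0"
    then have "walsh n f 0 = 3 ^ n"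
      using CARD by (simp add: walsh_def omega_pow_0[OF three])
    moreover have "(cmod (walsh n f 0))\<^sup>2 = 3 ^ n"
      using bent(1) by (simp add: regular_bent_def bent_def)
    ultimately have "(3::real) ^ n * 3 ^ n = 3 ^ n"
      by (simp add: norm_power power2_eq_square)
    moreover have "1 < (3::real) ^ n"
      using assms(1,2) by (intro one_less_power) auto
    ultimately show False
      by simp
  qed
  then show ?thesis
    using algebraic_degree_quartic[OF CARD assms(2,1,8)] bent subset_completed_class by blast
qed

end
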